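(* Let $G$ be a finite simple graph with $n$ vertices and a fixed total order on $E(G)$, and let $x$ be a positive integer. Let $S$ be the set of pairs $(F,c)$ where $F$ is an internal spanning forest of $G$ and $c:V(G)\to\{1,\dots,x\}$ is a proper colouring of $F$. Then \[\tau_G(x)=(-1)^n\sum_{(F,c)\in S}(-1)^{|C(F)|},\] where $|C(F)|$ is the number of connected components of $F$.
   Context: A broken circuit is the edge set of a cycle of $G$ with its smallest edge removed; $B_G$ is the set of all $S\subseteq E(G)$ containing no broken circuit. A spanning forest $F$ of $G$ is internal if $E(F)\in B_G$ (equivalently, no edge $e\notin E(F)$ closes a cycle in $F\cup e$ in which $e$ is the minimal edge). $X_G=\sum_\kappa\prod_v x_{\kappa(v)}$ over proper colourings $\kappa:V(G)\to\{1,2,\dots\}$; $P_\lambda$ is the disjoint union of paths with $\lambda_1,\dots,\lambda_{\ell(\lambda)}$ vertices; $\{X_{P_\lambda}\}$ is a basis of the symmetric functions over $\mathbb{Q}$; and $\tau_G(x)=\sum_\lambda a_\lambda x^{\ell(\lambda)}$ where $X_G=\sum_\lambda a_\lambda X_{P_\lambda}$. *)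

theory Defs
  imports Complex_Main "HOL-Library.FuncSet"
begin

text \<open>A finite simple graph is given by a finite vertex set V and an edge set E of
  2-element subsets of V.  Edge sets of graphs are sets of such unordered pairs.\<close>

definition simple_graph :: "'a set \<Rightarrow> 'a set set \<Rightarrow> bool" where
  "simple_graph V E \<longleftrightarrow> finite V \<and> E \<subseteq> {{u, v} | u v. u \<in> V \<and> v \<in> V \<and> u \<noteq> v}"

text \<open>C is the edge set of a cycle of the graph (V, E).\<close>
definition is_cycle :: "'a set \<Rightarrow> 'a set set \<Rightarrow> 'a set set \<Rightarrow> bool" where
  "is_cycle V E C \<longleftrightarrow> C \<subseteq> E \<and> (\<exists>vs. distinct vs \<and> length vs \<ge> 3 \<and> set vs \<subseteq> V \<and>
      C = {{vs ! i, vs ! ((i + 1) mod length vs)} | i. i < length vs})"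

text \<open>Broken circuits w.r.t. the total order r on E ((e,f) \<in> r means e \<le> f).\<close>
definition broken_circuit :: "'a set \<Rightarrow> 'a set set \<Rightarrow> 'a set rel \<Rightarrow> 'a set set \<Rightarrow> bool" where
  "broken_circuit V E r B \<longleftrightarrow>
     (\<exists>C e. is_cycle V E C \<and> e \<in> C \<and> (\<forall>f\<in>C. (e, f) \<in> r) \<and> B = C - {e})"

definition nbc_sets :: "'a set \<Rightarrow> 'a set set \<Rightarrow> 'a set rel \<Rightarrow> 'a set set set" where
  "nbc_sets V E r = {S. S \<subseteq> E \<and> \<not> (\<exists>B. broken_circuit V E r B \<and> B \<subseteq> S)}"

text \<open>Spanning forests of (V,E), identified with their edge sets (vertex set V).\<close>
definition spanning_forest :: "'a set \<Rightarrow> 'a set set \<Rightarrow> 'a set set \<Rightarrow> bool" where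
  "spanning_forest V E F \<longleftrightarrow> F \<subseteq> E \<and> \<not> (\<exists>C. is_cycle V F C)"

definition internal_forest :: "'a set \<Rightarrow> 'a set set \<Rightarrow> 'a set rel \<Rightarrow> 'a set set \<Rightarrow> bool" where
  "internal_forest V E r F \<longleftrightarrow> spanning_forest V E F \<and> F \<in> nbc_sets V E r"

definition adj_rel :: "'a set set \<Rightarrow> 'a rel" where
  "adj_rel F = {(u, v). {u, v} \<in> F}"

text \<open>Number of connected components of the graph (V, F).\<close>
definition num_components :: "'a set \<Rightarrow> 'a set set \<Rightarrow> nat" where
  "num_components V F = card (V // (adj_rel F)\<^sup>*)"

definition proper_colouring :: "'a set set \<Rightarrow> ('a \<Rightarrow> nat) \<Rightarrow> bool" where
  "proper_colouring F c \<longleftrightarrow> (\<forall>e\<in>F. \<forall>u v. e = {u, v} \<longrightarrow> u \<noteq> v \<longrightarrow> c u \<noteq> c v)"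

text \<open>Chromatic symmetric function X_G, represented by its coefficients:
  the coefficient of the monomial \<Prod>_i x_i^(\<alpha> i) is the number of proper colourings
  \<kappa> : V \<rightarrow> {1,2,...} using colour i exactly \<alpha> i times.\<close>
definition chrom_coeff :: "'a set \<Rightarrow> 'a set set \<Rightarrow> (nat \<Rightarrow> nat) \<Rightarrow> nat" where
  "chrom_coeff V E \<alpha> = card {\<kappa> \<in> V \<rightarrow>\<^sub>E {1..}. proper_colouring E \<kappa> \<and>
       (\<forall>i. card {v \<in> V. \<kappa> v = i} = \<alpha> i)}"

text \<open>Integer partitions: weakly decreasing lists of positive integers.\<close>
definition is_partition :: "nat list \<Rightarrow> bool" where
  "is_partition ls \<longleftrightarrow> sorted (rev ls) \<and> (\<forall>k\<in>set ls. 0 < k)"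

text \<open>P_ls: disjoint union of paths with ls_1, ..., ls_l vertices;
  vertex (j,k) is the k-th vertex of the j-th path.\<close>
definition path_vertices :: "nat list \<Rightarrow> (nat \<times> nat) set" where
  "path_vertices ls = {(j, k). j < length ls \<and> k < ls ! j}"

definition path_edges :: "nat list \<Rightarrow> (nat \<times> nat) set set" where
  "path_edges ls = {{(j, k), (j, k + 1)} | j k. j < length ls \<and> k + 1 < ls ! j}"

text \<open>a is the (finitely supported) coefficient vector of X_G in the basis X_{P_ls}.\<close>
definition path_expansion :: "'a set \<Rightarrow> 'a set set \<Rightarrow> (nat list \<Rightarrow> rat) \<Rightarrow> bool" where
  "path_expansion V E a \<longleftrightarrow>
     finite {ls. a ls \<noteq> 0} \<and> (\<forall>ls. a ls \<noteq> 0 \<longrightarrow> is_partition ls) \<and>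
     (\<forall>\<alpha>. of_nat (chrom_coeff V E \<alpha>) =
            (\<Sum>ls\<in>{ls. a ls \<noteq> 0}. a ls * of_nat (chrom_coeff (path_vertices ls) (path_edges ls) \<alpha>)))"

definition path_coeffs :: "'a set \<Rightarrow> 'a set set \<Rightarrow> nat list \<Rightarrow> rat" where
  "path_coeffs V E = (THE a. path_expansion V E a)"

definition tau :: "'a set \<Rightarrow> 'a set set \<Rightarrow> rat \<Rightarrow> rat" where
  "tau V E y = (\<Sum>ls\<in>{ls. path_coeffs V E ls \<noteq> 0}. path_coeffs V E ls * y ^ length ls)"

end

theory Submission
  imports Defs "HOL-Library.Function_Algebras" "HOL-Library.Transitive_Closure_Table"
    "HOL-Combinatorics.List_Permutation"
begin

text \<open>For a colouring \<open>\<kappa>\<close> with set \<open>T\<close> of monochromatic edges, the signed sum of \<open>(-1)\<^sup>|\<^sup>F\<^sup>|\<close>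
  over the sets \<open>F \<subseteq> T\<close> without broken circuits is \<open>1\<close> if \<open>T\<close> is empty and \<open>0\<close> otherwise. Hence
  \<open>X\<^sub>G\<close> is the signed sum of the power sums \<open>p(F)\<close> of the component sizes of the internal
  forests \<open>F\<close>. Let \<open>\<phi>\<close> be the linear map sending \<open>X\<^sub>P\<close> to \<open>x\<^sup>\<ell>\<close> for a union \<open>P\<close> of \<open>\<ell>\<close> paths, so that
  \<open>\<tau>\<^sub>G(x) = \<phi>(X\<^sub>G)\<close>. Realise \<open>p(F)\<close> by a union of paths on the component sizes all of whose edges are
  required to be monochromatic. Colourings with distinct ends of an edge
  are those without a condition on it minus those with equal ends, so \<open>\<phi>(p(F))\<close> has a factor \<open>x\<close> for
  each component and a factor \<open>x - 1\<close> for each edge of \<open>F\<close>; by the same recursion, this is the number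
  of proper \<open>x\<close>-colourings of \<open>F\<close>.\<close>

section \<open>Colourings with proper and monochromatic edges\<close>

definition edge_constant :: "'a set set \<Rightarrow> ('a \<Rightarrow> nat) \<Rightarrow> bool" where
  "edge_constant S \<kappa> \<longleftrightarrow> (\<forall>e\<in>S. \<forall>u\<in>e. \<forall>v\<in>e. \<kappa> u = \<kappa> v)"

text \<open>The set \<open>K\<close> is a parameter so that one deletion rule serves both settings:
  \<open>content_maps V \<alpha>\<close> for the coefficients of symmetric functions, and colourings
  with \<open>x\<close> colours for plain counts.\<close>

definition mixed_colourings ::
  "('a \<Rightarrow> nat) set \<Rightarrow> 'a set set \<Rightarrow> 'a set set \<Rightarrow> ('a \<Rightarrow> nat) set" where
  "mixed_colourings K D S = {\<kappa> \<in> K. proper_colouring D \<kappa> \<and> edge_constant S \<kappa>}"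

text \<open>The colourings that contribute to one monomial. Identities between symmetric functions
  thus become identities between cardinalities, one for each exponent vector
  \<open>\<alpha>\<close>.\<close>

definition content_maps :: "'a set \<Rightarrow> (nat \<Rightarrow> nat) \<Rightarrow> ('a \<Rightarrow> nat) set" where
  "content_maps V \<alpha> = {\<kappa> \<in> V \<rightarrow>\<^sub>E {1..}. \<forall>i. card {v \<in> V. \<kappa> v = i} = \<alpha> i}"

definition graph_edges :: "'a set \<Rightarrow> 'a set set" where
  "graph_edges V = {{u, v} | u v. u \<in> V \<and> v \<in> V \<and> u \<noteq> v}"

lemma graph_edgesE:
  assumes "e \<in> graph_edges V"
  obtains u v where "e = {u, v}" "u \<in> V" "v \<in> V" "u \<noteq> v"
  using assms by (auto simp: graph_edges_def)

lemma finite_graph_edges: "finite V \<Longrightarrow> finite (graph_edges V)"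
  by (rule finite_subset[of _ "Pow V"]) (auto simp: graph_edges_def)

text \<open>Injectivity on an edge mentions no choice of end points, so it passes through images
  under a bijection of the vertices.\<close>

lemma proper_colouring_iff_inj_on:
  assumes "D \<subseteq> graph_edges V"
  shows "proper_colouring D \<kappa> \<longleftrightarrow> (\<forall>e\<in>D. inj_on \<kappa> e)"
proof -
  have "inj_on \<kappa> e \<longleftrightarrow> (\<forall>u v. e = {u, v} \<longrightarrow> u \<noteq> v \<longrightarrow> \<kappa> u \<noteq> \<kappa> v)" if "e \<in> D" for e
  proof -
    obtain a b where "e = {a, b}" "a \<noteq> b"
      using assms \<open>e \<in> D\<close> by (meson graph_edgesE subsetD)
    then show ?thesis by (auto simp: doubleton_eq_iff)
  qed
  then show ?thesis by (auto simp: proper_colouring_def)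
qed

lemma chrom_coeff_eq: "chrom_coeff V E \<alpha> = card (mixed_colourings (content_maps V \<alpha>) E {})"
  unfolding chrom_coeff_def mixed_colourings_def content_maps_def edge_constant_def
  by (rule arg_cong[where f = card]) auto

text \<open>Infinitely many colours are available, but the content fixes the image of a colouring as
  the support of \<open>\<alpha>\<close>. A single colouring with this content already shows the
  support to be finite.\<close>

lemma finite_content_maps:
  assumes "finite V"
  shows "finite (content_maps V \<alpha>)"
proof (cases "content_maps V \<alpha> = {}")
  case False
  have image: "\<kappa> ` V = {i. \<alpha> i \<noteq> 0}" if "\<kappa> \<in> content_maps V \<alpha>" for \<kappa>
  proof -
    have "\<alpha> i = card {v \<in> V. \<kappa> v = i}" for i
      using that by (simp add: content_maps_def)
    then have "\<alpha> i = 0 \<longleftrightarrow> {v \<in> V. \<kappa> v = i} = {}" for i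
      using assms by simp
    then show ?thesis by auto
  qed
  from False obtain \<kappa>\<^sub>0 where "\<kappa>\<^sub>0 \<in> content_maps V \<alpha>" by auto
  then have "finite {i. \<alpha> i \<noteq> 0}" using image assms by (metis finite_imageI)
  moreover have "content_maps V \<alpha> \<subseteq> V \<rightarrow>\<^sub>E {i. \<alpha> i \<noteq> 0}"
  proof
    fix \<kappa> assume "\<kappa> \<in> content_maps V \<alpha>"
    then have "\<kappa> \<in> extensional V" "\<kappa> ` V = {i. \<alpha> i \<noteq> 0}"
      using image by (simp_all add: content_maps_def PiE_def)
    then show "\<kappa> \<in> V \<rightarrow>\<^sub>E {i. \<alpha> i \<noteq> 0}" by (auto simp: PiE_def)
  qed
  ultimately show ?thesis
    using finite_PiE[OF assms, of "\<lambda>_. {i. \<alpha> i \<noteq> 0}"] by (simp add: finite_subset)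
qed simp

lemma proper_colouring_insert:
  "proper_colouring (insert e D) \<kappa> \<longleftrightarrow> proper_colouring {e} \<kappa> \<and> proper_colouring D \<kappa>"
  by (simp only: proper_colouring_def ball_simps simp_thms)

lemma edge_constant_insert:
  "edge_constant (insert e S) \<kappa> \<longleftrightarrow> edge_constant {e} \<kappa> \<and> edge_constant S \<kappa>"
  by (simp add: edge_constant_def)

lemma proper_colouring_doubleton: "u \<noteq> v \<Longrightarrow> proper_colouring {{u, v}} \<kappa> \<longleftrightarrow> \<kappa> u \<noteq> \<kappa> v"
  unfolding proper_colouring_def by (metis doubleton_eq_iff singletonD singletonI)

lemma edge_constant_doubleton: "edge_constant {{u, v}} \<kappa> \<longleftrightarrow> \<kappa> u = \<kappa> v"
  by (auto simp: edge_constant_def)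

text \<open>Deletion-contraction: the ends of the edge get either different or equal colours. The
  contraction is expressed by an equality condition instead of a quotient graph, so the vertex set
  and the contents do not change.\<close>

lemma card_mixed_colourings_delete:
  assumes "finite K" "u \<noteq> v"
  shows "card (mixed_colourings K D S) =
    card (mixed_colourings K (insert {u, v} D) S) + card (mixed_colourings K D (insert {u, v} S))"
proof -
  let ?A = "mixed_colourings K (insert {u, v} D) S"
  let ?B = "mixed_colourings K D (insert {u, v} S)"
  have A: "?A = {\<kappa> \<in> mixed_colourings K D S. \<kappa> u \<noteq> \<kappa> v}"
    unfolding mixed_colourings_def proper_colouring_insert[of "{u, v}" D]
      proper_colouring_doubleton[OF \<open>u \<noteq> v\<close>] by blast
  have B: "?B = {\<kappa> \<in> mixed_colourings K D S. \<kappa> u = \<kappa> v}"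
    unfolding mixed_colourings_def edge_constant_insert[of "{u, v}" S] edge_constant_doubleton by blast
  have "finite (mixed_colourings K D S)"
    using \<open>finite K\<close> by (simp add: mixed_colourings_def)
  then have "card (?A \<union> ?B) = card ?A + card ?B"
    unfolding A B by (intro card_Un_disjoint) auto
  moreover have "?A \<union> ?B = mixed_colourings K D S"
    unfolding A B by blast
  ultimately show ?thesis by simp
qed

section \<open>Transport of colourings along bijections of the vertices\<close>

lemma bij_betw_content_maps:
  assumes "bij_betw g V V'"
  shows "bij_betw (\<lambda>\<kappa>. restrict (\<kappa> \<circ> g) V) (content_maps V' \<alpha>) (content_maps V \<alpha>)"
proof -
  \<comment> \<open>Stated for an arbitrary bijection, so that it applies to \<open>g\<close> and to
    its inverse.\<close>
  have *: "restrict (\<kappa> \<circ> h) W \<in> content_maps W \<alpha>"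
    if "bij_betw h W W'" "\<kappa> \<in> content_maps W' \<alpha>" for h and W :: "'c set" and W' :: "'d set" and \<kappa>
  proof -
    have "card {w \<in> W. restrict (\<kappa> \<circ> h) W w = i} = card {w \<in> W'. \<kappa> w = i}" for i
    proof (rule bij_betw_same_card)
      show "bij_betw h {w \<in> W. restrict (\<kappa> \<circ> h) W w = i} {w \<in> W'. \<kappa> w = i}"
        using that(1) by (auto simp: bij_betw_def inj_on_def)
    qed
    with that show ?thesis
      by (auto simp: content_maps_def bij_betw_def PiE_iff)
  qed
  let ?h = "inv_into V g"
  have h: "bij_betw ?h V' V" using assms by (rule bij_betw_inv_into)
  show ?thesis
  proof (rule bij_betw_byWitness[where f' = "\<lambda>\<kappa>. restrict (\<kappa> \<circ> ?h) V'"])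
    show "\<forall>\<kappa>\<in>content_maps V' \<alpha>. restrict (restrict (\<kappa> \<circ> g) V \<circ> ?h) V' = \<kappa>"
    proof
      fix \<kappa> assume "\<kappa> \<in> content_maps V' \<alpha>"
      then have ext: "\<kappa> \<in> extensional V'" by (auto simp: content_maps_def PiE_def)
      show "restrict (restrict (\<kappa> \<circ> g) V \<circ> ?h) V' = \<kappa>"
      proof
        fix w show "restrict (restrict (\<kappa> \<circ> g) V \<circ> ?h) V' w = \<kappa> w"
          using ext assms h by (auto simp: restrict_def extensional_def bij_betw_def f_inv_into_f inv_into_into)
      qed
    qed
    show "\<forall>\<kappa>\<in>content_maps V \<alpha>. restrict (restrict (\<kappa> \<circ> ?h) V' \<circ> g) V = \<kappa>"
    proof
      fix \<kappa> assume "\<kappa> \<in> content_maps V \<alpha>"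
      then have ext: "\<kappa> \<in> extensional V" by (auto simp: content_maps_def PiE_def)
      show "restrict (restrict (\<kappa> \<circ> ?h) V' \<circ> g) V = \<kappa>"
      proof
        fix w show "restrict (restrict (\<kappa> \<circ> ?h) V' \<circ> g) V w = \<kappa> w"
          using ext assms by (auto simp: restrict_def extensional_def bij_betw_def)
      qed
    qed
    show "(\<lambda>\<kappa>. restrict (\<kappa> \<circ> g) V) ` content_maps V' \<alpha> \<subseteq> content_maps V \<alpha>"
      using *[OF assms] by (rule image_subsetI)
    show "(\<lambda>\<kappa>. restrict (\<kappa> \<circ> ?h) V') ` content_maps V \<alpha> \<subseteq> content_maps V' \<alpha>"
      using *[OF h] by (rule image_subsetI)
  qed
qed

text \<open>The predicates are arbitrary, which covers graph isomorphisms and also bijections that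
  do not carry edges to edges, as in \<open>components_as_paths\<close>.\<close>

lemma card_content_maps_reindex:
  assumes "bij_betw g V V'" and "\<And>\<kappa>. P (restrict (\<kappa> \<circ> g) V) \<longleftrightarrow> P' \<kappa>"
  shows "card {\<kappa> \<in> content_maps V \<alpha>. P \<kappa>} = card {\<kappa> \<in> content_maps V' \<alpha>. P' \<kappa>}"
proof -
  let ?f = "\<lambda>\<kappa>. restrict (\<kappa> \<circ> g) V"
  have f: "bij_betw ?f (content_maps V' \<alpha>) (content_maps V \<alpha>)"
    using bij_betw_content_maps[OF assms(1)] .
  have "bij_betw ?f {\<kappa> \<in> content_maps V' \<alpha>. P' \<kappa>} {\<kappa> \<in> content_maps V \<alpha>. P \<kappa>}"
    using f assms(2) unfolding bij_betw_def by (fastforce simp: inj_on_def image_iff)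
  then show ?thesis by (simp add: bij_betw_same_card)
qed

lemma card_mixed_colourings_iso:
  assumes g: "bij_betw g V V'" and D: "D \<subseteq> graph_edges V" and S: "S \<subseteq> graph_edges V"
  shows "card (mixed_colourings (content_maps V \<alpha>) D S) =
    card (mixed_colourings (content_maps V' \<alpha>) ((`) g ` D) ((`) g ` S))"
  unfolding mixed_colourings_def
proof (rule card_content_maps_reindex[OF g])
  fix \<kappa> :: "'b \<Rightarrow> nat"
  have sub: "e \<subseteq> V" if "e \<in> D \<union> S" for e
    using D S that by (auto simp: graph_edges_def)
  have D': "(`) g ` D \<subseteq> graph_edges V'"
  proof
    fix e' assume "e' \<in> (`) g ` D"
    then obtain e where "e \<in> D" "e' = g ` e" by auto
    then obtain a b where "e = {a, b}" "a \<in> V" "b \<in> V" "a \<noteq> b"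
      using D by (meson graph_edgesE subsetD)
    moreover from this have "g a \<noteq> g b" "g a \<in> V'" "g b \<in> V'"
      using g by (auto simp: bij_betw_def dest: inj_onD)
    ultimately show "e' \<in> graph_edges V'"
      using \<open>e' = g ` e\<close> by (auto simp: graph_edges_def)
  qed
  have "inj_on (restrict (\<kappa> \<circ> g) V) e \<longleftrightarrow> inj_on \<kappa> (g ` e)" if "e \<in> D" for e
  proof -
    have "inj_on g e"
      using g sub that by (metis UnI1 bij_betw_def inj_on_subset)
    have "inj_on (restrict (\<kappa> \<circ> g) V) e \<longleftrightarrow> inj_on (\<kappa> \<circ> g) e"
      using sub[of e] that by (intro inj_on_cong) auto
    with \<open>inj_on g e\<close> show ?thesis by (simp add: comp_inj_on_iff)
  qed
  then have "proper_colouring D (restrict (\<kappa> \<circ> g) V) \<longleftrightarrow> proper_colouring ((`) g ` D) \<kappa>"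
    by (simp add: proper_colouring_iff_inj_on[OF D] proper_colouring_iff_inj_on[OF D'])
  moreover have "edge_constant S (restrict (\<kappa> \<circ> g) V) \<longleftrightarrow> edge_constant ((`) g ` S) \<kappa>"
  proof -
    have "restrict (\<kappa> \<circ> g) V u = \<kappa> (g u)" if "e \<in> S" "u \<in> e" for e u
      using sub[of e] that by auto
    then show ?thesis by (simp add: edge_constant_def)
  qed
  ultimately show "(proper_colouring D (restrict (\<kappa> \<circ> g) V) \<and> edge_constant S (restrict (\<kappa> \<circ> g) V)) =
    (proper_colouring ((`) g ` D) \<kappa> \<and> edge_constant ((`) g ` S) \<kappa>)" by simp
qed

section \<open>Broken circuits\<close>

text \<open>The rest of the cycle is a path joining the two ends of \<open>e\<close>, and the colour
  does not change along it.\<close>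

lemma edge_constant_cycle_closed:
  assumes "is_cycle V E C" "e \<in> C" "edge_constant (C - {e}) \<kappa>"
  shows "edge_constant {e} \<kappa>"
proof -
  obtain vs where vs: "distinct vs" "length vs \<ge> 3"
      and C: "C = {{vs ! i, vs ! ((i + 1) mod length vs)} | i. i < length vs}"
    using assms(1) by (auto simp: is_cycle_def)
  let ?n = "length vs"
  obtain i where i: "i < ?n" "e = {vs ! i, vs ! ((i + 1) mod ?n)}"
    using C \<open>e \<in> C\<close> by auto
  have step: "\<kappa> (vs ! j) = \<kappa> (vs ! ((j + 1) mod ?n))" if j: "j < ?n" "j \<noteq> i" for j
  proof -
    let ?f = "{vs ! j, vs ! ((j + 1) mod ?n)}"
    \<comment> \<open>Two different positions can give the same unordered pair only with the ends
      swapped; then \<open>i + 2\<close> and \<open>i\<close> agree modulo the length, which a cycle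
      of length at least 3 excludes.\<close>
    have "?f \<noteq> e"
    proof
      assume "?f = e"
      moreover have "(i + 1) mod ?n < ?n" "(j + 1) mod ?n < ?n"
        using vs(2) by (auto intro!: mod_less_divisor)
      ultimately have "j = (i + 1) mod ?n" "(j + 1) mod ?n = i"
        using i j vs(1) by (auto simp: doubleton_eq_iff nth_eq_iff_index_eq)
      then have "(i + 2) mod ?n = i mod ?n"
        using i(1) by (metis (no_types, lifting) add.assoc mod_add_left_eq mod_less one_add_one)
      then show False
        using vs(2) i(1) by (cases "i + 2 < ?n") (auto simp: mod_if split: if_splits)
    qed
    then have "?f \<in> C - {e}" using C j(1) by auto
    then show ?thesis using assms(3) by (auto simp: edge_constant_def)
  qed
  have "\<kappa> (vs ! ((i + 1 + t) mod ?n)) = \<kappa> (vs ! ((i + 1) mod ?n))" if "t < ?n" for t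
    using that
  proof (induction t)
    case (Suc t)
    let ?j = "(i + 1 + t) mod ?n"
    have "?j < ?n" using vs(2) by (auto intro!: mod_less_divisor)
    moreover have "?j \<noteq> i" using Suc.prems i(1) by (auto simp: mod_if split: if_splits)
    ultimately have "\<kappa> (vs ! ?j) = \<kappa> (vs ! ((?j + 1) mod ?n))" by (rule step)
    moreover have "(?j + 1) mod ?n = (i + 1 + Suc t) mod ?n"
      by (simp add: mod_Suc_eq)
    ultimately show ?case using Suc by simp
  qed simp
  \<comment> \<open>From position \<open>i + 1\<close>, a walk of \<open>?n - 1\<close> steps
    avoiding \<open>e\<close> arrives at position \<open>i\<close>, the other end of
    \<open>e\<close>.\<close>
  from this[of "?n - 1"] have "\<kappa> (vs ! i) = \<kappa> (vs ! ((i + 1) mod ?n))"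
    using i(1) vs(2) by (simp flip: Suc_diff_le)
  then show ?thesis using i(2) by (auto simp: edge_constant_def)
qed

lemma linear_order_on_finite_least:
  assumes "linear_order_on E r" "finite T" "T \<noteq> {}" "T \<subseteq> E"
  obtains m where "m \<in> T" "\<forall>f\<in>T. (m, f) \<in> r"
proof -
  have "\<exists>m\<in>T. \<forall>f\<in>T. (m, f) \<in> r"
    using assms(2-4)
  proof (induction T rule: finite_ne_induct)
    case (singleton a)
    then show ?case
      using assms(1) by (auto simp: order_on_defs refl_on_def)
  next
    case (insert a T)
    then obtain m where m: "m \<in> T" "\<forall>f\<in>T. (m, f) \<in> r" by auto
    have "trans r" "(a, m) \<in> r \<or> (m, a) \<in> r" "(a, a) \<in> r"
      using assms(1) insert.prems m(1) insert.hyps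
      by (auto simp: order_on_defs total_on_def refl_on_def)
    then show ?case
    proof (elim disjE)
      assume "(a, m) \<in> r"
      then have "\<forall>f\<in>insert a T. (a, f) \<in> r"
        using m(2) \<open>trans r\<close> \<open>(a, a) \<in> r\<close> by (auto dest: transD)
      then show ?thesis by auto
    next
      assume "(m, a) \<in> r"
      then show ?thesis using m by auto
    qed
  qed
  then show ?thesis using that by blast
qed

text \<open>A cycle inside \<open>F\<close> would contain the broken circuit obtained by removing
  its own least edge. Hence the edge sets without broken circuits are exactly those of the internal
  forests.\<close>

lemma nbc_sets_acyclic:
  assumes "finite E" "linear_order_on E r" "F \<in> nbc_sets V E r"
  shows "\<not> is_cycle V F C"
proof
  assume cyc: "is_cycle V F C"
  have "F \<subseteq> E" using assms(3) by (simp add: nbc_sets_def)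
  from cyc obtain vs where "length vs \<ge> 3" "C \<subseteq> F"
      "C = {{vs ! i, vs ! ((i + 1) mod length vs)} | i. i < length vs}"
    by (auto simp: is_cycle_def)
  then have "{vs ! 0, vs ! ((0 + 1) mod length vs)} \<in> C" by fastforce
  then have "C \<noteq> {}" by auto
  moreover have "finite C" "C \<subseteq> E"
    using \<open>C \<subseteq> F\<close> \<open>F \<subseteq> E\<close> \<open>finite E\<close> by (auto intro: finite_subset)
  ultimately obtain m where "m \<in> C" "\<forall>f\<in>C. (m, f) \<in> r"
    using linear_order_on_finite_least[OF assms(2)] by metis
  moreover have "is_cycle V E C"
    using cyc \<open>F \<subseteq> E\<close> by (auto simp: is_cycle_def)
  ultimately have "broken_circuit V E r (C - {m})"
    by (auto simp: broken_circuit_def)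
  then show False using assms(3) \<open>C \<subseteq> F\<close> by (auto simp: nbc_sets_def)
qed

text \<open>Toggling the least edge of the nonempty set \<open>T\<close> of monochromatic edges preserves
  the absence of broken circuits: a broken circuit created by adding it would be completed by a
  smaller edge, which is again monochromatic.\<close>
lemma sum_nbc_sets_monochromatic:
  fixes \<kappa> :: "'a \<Rightarrow> nat"
  assumes "finite E" "linear_order_on E r"
  defines "T \<equiv> {e \<in> E. edge_constant {e} \<kappa>}"
  shows "(\<Sum>F\<in>{F \<in> nbc_sets V E r. F \<subseteq> T}. (-1) ^ card F) = (if T = {} then 1 else 0 :: rat)"
proof -
  have closed: "e \<in> T" if "is_cycle V E C" "e \<in> C" "C - {e} \<subseteq> T" for C e
  proof -
    have "edge_constant (C - {e}) \<kappa>" using that(3) by (auto simp: T_def edge_constant_def)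
    then show ?thesis
      using edge_constant_cycle_closed[OF that(1,2)] that(1,2) by (auto simp: T_def is_cycle_def)
  qed
  let ?N = "{F \<in> nbc_sets V E r. F \<subseteq> T}"
  show ?thesis
  proof (cases "T = {}")
    case True
    \<comment> \<open>An empty broken circuit would come from a cycle whose only edge
      \<open>e\<close> lies in \<open>T\<close> by \<open>closed\<close>, although \<open>T\<close>
      is empty.\<close>
    have "\<not> broken_circuit V E r {}"
      using closed True by (auto simp: broken_circuit_def)
    then have "?N = {{}}" using True by (auto simp: nbc_sets_def)
    then show ?thesis using True by simp
  next
    case False
    have "T \<subseteq> E" by (auto simp: T_def)
    have "finite T" using \<open>T \<subseteq> E\<close> \<open>finite E\<close> finite_subset by blast
    obtain m where m: "m \<in> T" "\<forall>f\<in>T. (m, f) \<in> r"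
      using linear_order_on_finite_least[OF assms(2) \<open>finite T\<close> False \<open>T \<subseteq> E\<close>] .
    have insert: "insert m F \<in> ?N" if F: "F \<in> ?N" for F
    proof -
      have "\<not> B \<subseteq> insert m F" if B: "broken_circuit V E r B" for B
      proof
        assume sub: "B \<subseteq> insert m F"
        obtain C e where C: "is_cycle V E C" "e \<in> C" "\<forall>f\<in>C. (e, f) \<in> r" "B = C - {e}"
          using B by (auto simp: broken_circuit_def)
        have "\<not> B \<subseteq> F" using F B by (auto simp: nbc_sets_def)
        with sub C(4) have "m \<in> C" "m \<noteq> e" by auto
        have "e \<in> T" using closed[OF C(1,2)] sub C(4) F m(1) by auto
        then have "(m, e) \<in> r" "(e, m) \<in> r" using m C(3) \<open>m \<in> C\<close> by auto
        then show False
          using assms(2) \<open>m \<noteq> e\<close> by (auto simp: order_on_defs antisym_def)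
      qed
      then show ?thesis using F m(1) \<open>T \<subseteq> E\<close> by (auto simp: nbc_sets_def)
    qed
    have delete: "F - {m} \<in> ?N" if "F \<in> ?N" for F
      using that by (auto simp: nbc_sets_def)
    let ?A = "{F \<in> ?N. m \<notin> F}"
    have finF: "finite F" if "F \<in> ?N" for F
      using that \<open>finite T\<close> finite_subset by auto
    have finN: "finite ?N"
      by (rule finite_subset[of _ "Pow T"]) (use \<open>finite T\<close> in auto)
    \<comment> \<open>Each \<open>F\<close> without \<open>m\<close> is paired with
      \<open>insert m F\<close>, whose sign is opposite.\<close>
    have split: "?N = ?A \<union> insert m ` ?A"
    proof (intro equalityI subsetI)
      fix F assume F: "F \<in> ?N"
      show "F \<in> ?A \<union> insert m ` ?A"
      proof (cases "m \<in> F")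
        case True
        then have "F = insert m (F - {m})" by auto
        then show ?thesis using delete[OF F] by blast
      qed (use F in auto)
    qed (use insert in auto)
    have inj: "inj_on (insert m) ?A"
      by (rule inj_onI) (auto simp: insert_ident)
    have "(\<Sum>F\<in>?N. (-1) ^ card F) =
        (\<Sum>F\<in>?A. (-1) ^ card F) + (\<Sum>F\<in>insert m ` ?A. (-1) ^ card F :: rat)"
      by (subst split, rule sum.union_disjoint) (use finN in \<open>auto intro: finite_subset[OF _ finN]\<close>)
    also have "(\<Sum>F\<in>insert m ` ?A. (-1) ^ card F :: rat) = (\<Sum>F\<in>?A. - ((-1) ^ card F))"
      unfolding sum.reindex[OF inj] using finF by (intro sum.cong) auto
    finally show ?thesis using False by (simp add: sum_negf)
  qed
qed

text \<open>Whitney's expansion by broken circuits: for each \<open>\<kappa>\<close> the signed sum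
  over sets inside its monochromatic edges detects properness, and exchanging the two sums collects
  the colourings constant on a given \<open>F\<close>. With \<open>K\<close> a set of content maps
  this expands \<open>X\<close> in power sums.\<close>

lemma card_proper_eq_sum_nbc_sets:
  assumes "finite E" "linear_order_on E r" "E \<subseteq> graph_edges V" "finite K"
  shows "of_nat (card (mixed_colourings K E {})) =
    (\<Sum>F\<in>nbc_sets V E r. (-1) ^ card F * of_nat (card (mixed_colourings K {} F)) :: rat)"
proof -
  let ?T = "\<lambda>\<kappa>. {e \<in> E. edge_constant {e} \<kappa>}"
  have proper: "proper_colouring E \<kappa> \<longleftrightarrow> ?T \<kappa> = {}" for \<kappa>
  proof -
    have "inj_on \<kappa> e \<longleftrightarrow> \<not> edge_constant {e} \<kappa>" if "e \<in> E" for e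
    proof -
      have "e \<in> graph_edges V" using assms(3) that by auto
      then obtain u v where "e = {u, v}" "u \<noteq> v" by (rule graph_edgesE)
      then show ?thesis by (auto simp: edge_constant_def)
    qed
    then show ?thesis unfolding proper_colouring_iff_inj_on[OF assms(3)] by blast
  qed
  have const: "F \<subseteq> ?T \<kappa> \<longleftrightarrow> edge_constant F \<kappa>" if "F \<in> nbc_sets V E r" for F \<kappa>
  proof -
    have "F \<subseteq> E" using that by (simp add: nbc_sets_def)
    then show ?thesis unfolding edge_constant_def by blast
  qed
  have fin: "finite (nbc_sets V E r)"
    by (rule finite_subset[of _ "Pow E"]) (use assms(1) in \<open>auto simp: nbc_sets_def\<close>)
  have "mixed_colourings K E {} = {\<kappa> \<in> K. ?T \<kappa> = {}}"
    unfolding mixed_colourings_def proper edge_constant_def[of "{}"] by blast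
  then have "of_nat (card (mixed_colourings K E {})) = (\<Sum>\<kappa>\<in>{\<kappa> \<in> K. ?T \<kappa> = {}}. 1 :: rat)"
    by simp
  also have "\<dots> = (\<Sum>\<kappa>\<in>K. if ?T \<kappa> = {} then 1 else 0)"
    by (rule sum.inter_filter[OF \<open>finite K\<close>])
  also have "\<dots> = (\<Sum>\<kappa>\<in>K. \<Sum>F\<in>{F \<in> nbc_sets V E r. F \<subseteq> ?T \<kappa>}. (-1) ^ card F)"
    by (simp only: sum_nbc_sets_monochromatic[OF assms(1,2)])
  also have "\<dots> = (\<Sum>\<kappa>\<in>K. \<Sum>F\<in>{F \<in> nbc_sets V E r. edge_constant F \<kappa>}. (-1) ^ card F)"
    by (intro sum.cong refl) (use const in blast)+
  also have "\<dots> = (\<Sum>F\<in>nbc_sets V E r. \<Sum>\<kappa>\<in>{\<kappa> \<in> K. edge_constant F \<kappa>}. (-1) ^ card F)"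
    by (rule sum.swap_restrict) (use fin assms in auto)
  also have "\<dots> = (\<Sum>F\<in>nbc_sets V E r. (-1) ^ card F * of_nat (card (mixed_colourings K {} F)))"
    by (simp add: mixed_colourings_def proper_colouring_def mult.commute)
  finally show ?thesis .
qed

section \<open>Forests\<close>

lemma is_cycle_mono: "is_cycle V F C \<Longrightarrow> F \<subseteq> F' \<Longrightarrow> is_cycle V F' C"
  by (auto simp: is_cycle_def)

text \<open>A simple path from \<open>u\<close> to \<open>v\<close> in \<open>F\<close> is closed up
  by the new edge. It has at least two edges because \<open>{u, v}\<close> is not in
  \<open>F\<close>, so the cycle has at least three vertices.\<close>

lemma connected_imp_cycle:
  assumes "(u, v) \<in> (adj_rel F)\<^sup>*" "u \<noteq> v" "{u, v} \<notin> F" "F \<subseteq> graph_edges V" "u \<in> V"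
  shows "\<exists>C. is_cycle V (insert {u, v} F) C"
proof -
  let ?R = "\<lambda>a b. {a, b} \<in> F"
  have "adj_rel F = {(a, b). ?R a b}" by (simp add: adj_rel_def)
  with assms(1) have "?R\<^sup>*\<^sup>* u v" by (simp add: Enum.rtranclp_rtrancl_eq)
  then obtain xs where "rtrancl_path ?R u xs v" by (auto simp: rtranclp_eq_rtrancl_path)
  then obtain xs where xs: "rtrancl_path ?R u xs v" "distinct (u # xs)"
    by (rule rtrancl_path_distinct)
  let ?vs = "u # xs"
  have "xs \<noteq> []" using xs(1) \<open>u \<noteq> v\<close> by (auto elim: rtrancl_path.cases)
  have last: "last xs = v" using rtrancl_path_last[OF xs(1) \<open>xs \<noteq> []\<close>] .
  have "length xs \<noteq> 1"
  proof
    assume "length xs = 1"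
    then have "xs ! 0 = v" using last \<open>xs \<noteq> []\<close> by (simp add: last_conv_nth)
    then show False using rtrancl_path_nth[OF xs(1), of 0] \<open>xs \<noteq> []\<close> assms(3) by simp
  qed
  with \<open>xs \<noteq> []\<close> have "length ?vs \<ge> 3" by (cases xs) (auto simp: Suc_le_eq)
  \<comment> \<open>The last index wraps around to \<open>u\<close> and gives the new edge; every
    other index gives an edge of the path.\<close>
  have edge: "{?vs ! i, ?vs ! ((i + 1) mod length ?vs)} \<in> insert {u, v} F" if "i < length ?vs" for i
  proof (cases "i < length xs")
    case True
    then show ?thesis using rtrancl_path_nth[OF xs(1) True] by simp
  next
    case False
    with that have "i = length xs" by simp
    then have "?vs ! i = v" using last \<open>xs \<noteq> []\<close> by (simp add: last_conv_nth nth_Cons')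
    then show ?thesis using \<open>i = length xs\<close> by (simp add: insert_commute)
  qed
  have "set xs \<subseteq> V"
  proof
    fix w assume "w \<in> set xs"
    then obtain i where "i < length xs" "w = xs ! i" by (auto simp: in_set_conv_nth)
    then have "{?vs ! i, w} \<in> graph_edges V"
      using rtrancl_path_nth[OF xs(1)] assms(4) by blast
    then show "w \<in> V" by (auto simp: graph_edges_def doubleton_eq_iff)
  qed
  with edge \<open>length ?vs \<ge> 3\<close> xs(2) \<open>u \<in> V\<close>
  have "is_cycle V (insert {u, v} F) {{?vs ! i, ?vs ! ((i + 1) mod length ?vs)} | i. i < length ?vs}"
    unfolding is_cycle_def
    by (intro conjI exI[of _ ?vs]) (use edge \<open>set xs \<subseteq> V\<close> \<open>u \<in> V\<close> in auto)
  then show ?thesis by blast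
qed

section \<open>Connected components and the effect of adding an edge\<close>

lemma equiv_adj_rel_rtrancl: "equiv UNIV ((adj_rel F)\<^sup>*)"
  by (auto intro!: equivI refl_rtrancl sym_rtrancl trans_rtrancl
      simp: adj_rel_def sym_def insert_commute)

lemma adj_rel_rtrancl_closed:
  assumes "(u, v) \<in> (adj_rel F)\<^sup>*" "F \<subseteq> graph_edges V" "u \<in> V"
  shows "v \<in> V"
  using assms(1)
proof (cases rule: rtranclE)
  case (step w)
  then have "{w, v} \<in> graph_edges V" using assms(2) by (auto simp: adj_rel_def)
  then show ?thesis by (auto simp: graph_edges_def doubleton_eq_iff)
qed (use assms(3) in simp)

text \<open>Along a walk, the first use of the new edge shows that the start lies in the union of
  the classes of \<open>u\<close> and \<open>v\<close>; afterwards the walk cannot leave this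
  union.\<close>

lemma adj_rel_rtrancl_insert:
  "((adj_rel (insert {u, v} F))\<^sup>*) =
    (adj_rel F)\<^sup>* \<union> ((adj_rel F)\<^sup>* `` {u, v}) \<times> ((adj_rel F)\<^sup>* `` {u, v})"
  (is "?L = ?R \<union> ?W \<times> ?W")
proof
  have eq: "equiv UNIV ?R" "equiv UNIV ?L" by (rule equiv_adj_rel_rtrancl)+
  have sub: "?R \<subseteq> ?L" by (rule rtrancl_mono) (auto simp: adj_rel_def)
  have uv: "(u, v) \<in> ?L" by (auto simp: adj_rel_def)
  show "?R \<union> ?W \<times> ?W \<subseteq> ?L"
  proof (intro Un_least sub subsetI)
    fix p assume "p \<in> ?W \<times> ?W"
    then obtain a b where p: "p = (a, b)" "a \<in> ?W" "b \<in> ?W" by auto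
    have "(u, w) \<in> ?L" if "w \<in> ?W" for w
      using that sub uv equivE[OF eq(2)] by (auto dest: transD)
    then show "p \<in> ?L" using p eq(2) by (meson equivE symD transD)
  qed
  show "?L \<subseteq> ?R \<union> ?W \<times> ?W"
  proof
    fix p assume "p \<in> ?L"
    then obtain a b where p: "p = (a, b)" "(a, b) \<in> ?L" by (cases p) auto
    have symR: "sym ?R" and transR: "trans ?R" using eq(1) by (auto elim: equivE)
    from p(2) have "(a, b) \<in> ?R \<union> ?W \<times> ?W"
    proof (induction rule: rtrancl_induct)
      case (step c d)
      show ?case
      proof (cases "{c, d} \<in> F")
        case True
        then have "(c, d) \<in> ?R" by (auto simp: adj_rel_def)
        with step.IH show ?thesis by (auto intro: rtrancl_trans)
      next
        case False
        with step.hyps have "c \<in> {u, v}" "d \<in> {u, v}"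
          by (auto simp: adj_rel_def doubleton_eq_iff)
        then have "c \<in> ?W" "d \<in> ?W" by auto
        with step.IH symR transR show ?thesis
        proof (cases "(a, c) \<in> ?R")
          case True
          then have "(c, a) \<in> ?R" using symR by (auto dest: symD)
          then have "a \<in> ?W" using \<open>c \<in> {u, v}\<close> by auto
          with \<open>d \<in> ?W\<close> show ?thesis by auto
        qed auto
      qed
    qed simp
    with p show "p \<in> ?R \<union> ?W \<times> ?W" by simp
  qed
qed

text \<open>The quotient loses the two distinct classes of \<open>u\<close> and \<open>v\<close> and
  gains their union.\<close>

lemma num_components_insert:
  assumes "finite V" "u \<in> V" "v \<in> V" "(u, v) \<notin> (adj_rel F)\<^sup>*"
  shows "num_components V F = Suc (num_components V (insert {u, v} F))"
proof -
  let ?R = "(adj_rel F)\<^sup>*"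
  let ?W = "?R `` {u, v}"
  let ?Q = "V // ?R - {?R `` {u}, ?R `` {v}}"
  have eq: "equiv UNIV ?R" by (rule equiv_adj_rel_rtrancl)
  have classes: "?R `` {a} = ?R `` {b} \<longleftrightarrow> (a, b) \<in> ?R" for a b
    using eq_equiv_class_iff[OF eq] by simp
  have in_W: "a \<in> ?W \<longleftrightarrow> ?R `` {a} \<in> {?R `` {u}, ?R `` {v}}" for a
    using classes by auto
  have img: "(adj_rel (insert {u, v} F))\<^sup>* `` {a} = (if a \<in> ?W then ?W else ?R `` {a})" for a
  proof (cases "a \<in> ?W")
    case True
    then have "?R `` {a} \<subseteq> ?W" using in_W by auto
    with True show ?thesis by (auto simp: adj_rel_rtrancl_insert)
  qed (auto simp: adj_rel_rtrancl_insert)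
  have "V // (adj_rel (insert {u, v} F))\<^sup>* = insert ?W ?Q"
  proof (intro equalityI subsetI)
    fix X assume "X \<in> V // (adj_rel (insert {u, v} F))\<^sup>*"
    then obtain a where "a \<in> V" "X = (if a \<in> ?W then ?W else ?R `` {a})"
      using img by (auto elim!: quotientE)
    then show "X \<in> insert ?W ?Q" using in_W[of a] by (auto intro: quotientI)
  next
    fix X assume X: "X \<in> insert ?W ?Q"
    show "X \<in> V // (adj_rel (insert {u, v} F))\<^sup>*"
    proof (cases "X = ?W")
      case True
      then have "X = (adj_rel (insert {u, v} F))\<^sup>* `` {u}" using img[of u] by auto
      then show ?thesis using \<open>u \<in> V\<close> by (simp add: quotientI)
    next
      case False
      with X obtain a where a: "a \<in> V" "X = ?R `` {a}" "X \<notin> {?R `` {u}, ?R `` {v}}"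
        by (auto elim!: quotientE)
      then have "X = (adj_rel (insert {u, v} F))\<^sup>* `` {a}" using img[of a] in_W[of a] by simp
      then show ?thesis using \<open>a \<in> V\<close> by (simp add: quotientI)
    qed
  qed
  \<comment> \<open>Needed for the union to count as a new class: every point of \<open>?W\<close>
    has its old class among the two that were removed.\<close>
  moreover have "?W \<notin> ?Q"
  proof
    assume "?W \<in> ?Q"
    then obtain a where a: "?W = ?R `` {a}" "?R `` {a} \<notin> {?R `` {u}, ?R `` {v}}"
      by (auto elim!: quotientE)
    then have "a \<in> ?W" by auto
    then show False using a(2) in_W by blast
  qed
  moreover have fin: "finite (V // ?R)"
    using \<open>finite V\<close> by (simp add: quotient_def)
  moreover have "card ?Q + 2 = card (V // ?R)"
  proof -
    have sub: "{?R `` {u}, ?R `` {v}} \<subseteq> V // ?R" using assms(2,3) by (simp add: quotientI)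
    have two: "card {?R `` {u}, ?R `` {v}} = 2" using assms(4) classes[of u v] by simp
    show ?thesis
      using card_Diff_subset[OF _ sub] card_mono[OF fin sub] two by simp
  qed
  ultimately show ?thesis by (simp add: num_components_def)
qed

text \<open>The ends of the added edge cannot have been connected before, as otherwise
  \<open>connected_imp_cycle\<close> would produce a cycle.\<close>

lemma num_components_insert_forest:
  assumes "finite V" "insert e F \<subseteq> graph_edges V" "e \<notin> F" "\<nexists>C. is_cycle V (insert e F) C"
  shows "num_components V F = Suc (num_components V (insert e F))"
proof -
  have "e \<in> graph_edges V" using assms(2) by auto
  then obtain u v where e: "e = {u, v}" "u \<in> V" "v \<in> V" "u \<noteq> v" by (rule graph_edgesE)
  have "(u, v) \<notin> (adj_rel F)\<^sup>*"
    using connected_imp_cycle[of u v F V] assms e by auto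
  then show ?thesis using num_components_insert[OF assms(1) e(2,3)] e(1) by simp
qed

lemma num_components_empty:
  fixes V :: "'a set"
  shows "num_components V {} = card V"
proof -
  have "(adj_rel ({} :: 'a set set))\<^sup>* = Id" by (simp add: adj_rel_def)
  then have "V // (adj_rel {})\<^sup>* = (\<lambda>v. {v}) ` V" by (auto simp: quotient_def)
  then show ?thesis by (simp add: num_components_def card_image)
qed

lemma num_components_forest:
  assumes "finite V" "F \<subseteq> graph_edges V" "\<nexists>C. is_cycle V F C"
  shows "num_components V F + card F = card V"
proof -
  have "finite F" using assms(1,2) finite_graph_edges finite_subset by blast
  then show ?thesis using assms(2,3)
  proof (induction F rule: finite_induct)
    case empty
    then show ?case by (simp add: num_components_empty)
  next
    case (insert e F)
    have "\<nexists>C. is_cycle V F C" using insert.prems(2) is_cycle_mono by (metis subset_insertI)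
    then show ?case
      using insert num_components_insert_forest[OF assms(1) insert.prems(1) insert.hyps(2) insert.prems(2)]
      by simp
  qed
qed

section \<open>Counting the colourings of a forest with \<open>x\<close> colours\<close>

lemma edge_constant_iff_components:
  assumes "S \<subseteq> graph_edges V"
  shows "edge_constant S \<kappa> \<longleftrightarrow> (\<forall>(u, v)\<in>(adj_rel S)\<^sup>*. \<kappa> u = \<kappa> v)"
proof
  assume const: "edge_constant S \<kappa>"
  have "\<kappa> u = \<kappa> v" if "(u, v) \<in> (adj_rel S)\<^sup>*" for u v
    using that
  proof (induction rule: rtrancl_induct)
    case (step y z)
    then show ?case using const by (auto simp: adj_rel_def edge_constant_def)
  qed simp
  then show "\<forall>(u, v)\<in>(adj_rel S)\<^sup>*. \<kappa> u = \<kappa> v" by auto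
next
  assume *: "\<forall>(u, v)\<in>(adj_rel S)\<^sup>*. \<kappa> u = \<kappa> v"
  show "edge_constant S \<kappa>"
    unfolding edge_constant_def
  proof (intro ballI)
    fix e u v assume "e \<in> S" "u \<in> e" "v \<in> e"
    moreover from this obtain a b where "e = {a, b}"
      using assms by (auto simp: graph_edges_def)
    ultimately have "u = v \<or> (u, v) \<in> adj_rel S"
      by (auto simp: adj_rel_def insert_commute)
    then show "\<kappa> u = \<kappa> v" using * by auto
  qed
qed

text \<open>Such colourings are the functions on the set of components, pulled back along the map
  sending a vertex to its component.\<close>

lemma card_edge_constant:
  assumes "finite V" "S \<subseteq> graph_edges V"
  shows "card (mixed_colourings (V \<rightarrow>\<^sub>E {1..x}) {} S) = x ^ num_components V S"
proof -
  let ?R = "(adj_rel S)\<^sup>*"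
  let ?f = "\<lambda>g. restrict (\<lambda>v. g (?R `` {v})) V"
  have eq: "equiv UNIV ?R" by (rule equiv_adj_rel_rtrancl)
  have mixed: "mixed_colourings (V \<rightarrow>\<^sub>E {1..x}) {} S =
      {\<kappa> \<in> V \<rightarrow>\<^sub>E {1..x}. \<forall>(u, v)\<in>?R. \<kappa> u = \<kappa> v}"
    unfolding mixed_colourings_def proper_colouring_def edge_constant_iff_components[OF assms(2)]
    by auto
  have "inj_on ?f ((V // ?R) \<rightarrow>\<^sub>E {1..x})"
  proof (rule inj_onI)
    fix g h assume g: "g \<in> (V // ?R) \<rightarrow>\<^sub>E {1..x}" and h: "h \<in> (V // ?R) \<rightarrow>\<^sub>E {1..x}"
      and fgh: "?f g = ?f h"
    have "g X = h X" if X: "X \<in> V // ?R" for X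
    proof -
      obtain v where "v \<in> V" "X = ?R `` {v}" using X by (auto elim!: quotientE)
      with fun_cong[OF fgh, of v] show ?thesis by simp
    qed
    with g h show "g = h" by (auto intro: PiE_ext)
  qed
  moreover have "?f ` ((V // ?R) \<rightarrow>\<^sub>E {1..x}) = mixed_colourings (V \<rightarrow>\<^sub>E {1..x}) {} S"
  proof (intro equalityI subsetI)
    fix \<kappa> assume "\<kappa> \<in> ?f ` ((V // ?R) \<rightarrow>\<^sub>E {1..x})"
    then obtain g where g: "g \<in> (V // ?R) \<rightarrow>\<^sub>E {1..x}" "\<kappa> = ?f g" by auto
    have "\<kappa> u = \<kappa> v" if uv: "(u, v) \<in> ?R" for u v
    proof -
      have "(v, u) \<in> ?R" using uv eq by (meson equivE symD)
      \<comment> \<open>Related points lie both in \<open>V\<close> or both outside it; in the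
        second case the restriction gives both the same default value.\<close>
      then have "u \<in> V \<longleftrightarrow> v \<in> V" using adj_rel_rtrancl_closed[OF _ assms(2)] uv by blast
      moreover have "?R `` {u} = ?R `` {v}" using uv by (rule equiv_class_eq[OF eq])
      ultimately show ?thesis using g(2) by simp
    qed
    moreover have "\<kappa> \<in> V \<rightarrow>\<^sub>E {1..x}"
      unfolding g(2) using g(1) by (intro restrict_PiE_iff[THEN iffD2] ballI PiE_mem[OF g(1)] quotientI)
    ultimately show "\<kappa> \<in> mixed_colourings (V \<rightarrow>\<^sub>E {1..x}) {} S"
      unfolding mixed by auto
  next
    fix \<kappa> assume \<kappa>: "\<kappa> \<in> mixed_colourings (V \<rightarrow>\<^sub>E {1..x}) {} S"
    \<comment> \<open>The inverse map reads off \<open>\<kappa>\<close> at a chosen vertex of each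
      component; \<open>rep\<close> shows that the choice does not matter.\<close>
    define g where "g = restrict (\<lambda>X. \<kappa> (SOME v. v \<in> X)) (V // ?R)"
    have rep: "\<kappa> (SOME w. w \<in> ?R `` {v}) = \<kappa> v" for v
    proof -
      have "(v, SOME w. w \<in> ?R `` {v}) \<in> ?R"
        using someI[of "\<lambda>w. w \<in> ?R `` {v}" v] by auto
      then show ?thesis using \<kappa> unfolding mixed by fastforce
    qed
    have "\<kappa> = ?f g"
    proof
      fix v
      have "\<kappa> \<in> extensional V" using \<kappa> unfolding mixed by (auto simp: PiE_def)
      moreover have "g (?R `` {v}) = \<kappa> v" if "v \<in> V"
        unfolding g_def restrict_apply'[OF quotientI[OF that]] by (rule rep)
      ultimately show "\<kappa> v = ?f g v"
        by (cases "v \<in> V") (auto simp: extensional_def)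
    qed
    moreover have "g \<in> (V // ?R) \<rightarrow>\<^sub>E {1..x}"
      unfolding g_def
    proof (intro restrict_PiE_iff[THEN iffD2] ballI)
      fix X assume "X \<in> V // ?R"
      then obtain v where "v \<in> V" "X = ?R `` {v}" by (auto elim!: quotientE)
      then have "\<kappa> (SOME v. v \<in> X) = \<kappa> v" by (simp only: rep)
      moreover have "\<kappa> \<in> V \<rightarrow>\<^sub>E {1..x}" using \<kappa> unfolding mixed by blast
      ultimately show "\<kappa> (SOME v. v \<in> X) \<in> {1..x}" using \<open>v \<in> V\<close> PiE_mem by (metis (no_types))
    qed
    ultimately show "\<kappa> \<in> ?f ` ((V // ?R) \<rightarrow>\<^sub>E {1..x})" by (rule image_eqI)
  qed
  ultimately have "card (mixed_colourings (V \<rightarrow>\<^sub>E {1..x}) {} S) = card ((V // ?R) \<rightarrow>\<^sub>E {1..x})"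
    by (metis card_image)
  also have "finite (V // ?R)" using \<open>finite V\<close> by (simp add: quotient_def)
  then have "card ((V // ?R) \<rightarrow>\<^sub>E {1..x}) = x ^ num_components V S"
    by (simp add: card_PiE num_components_def)
  finally show ?thesis .
qed

text \<open>Induction on \<open>D\<close> by deletion: dropping an edge gives one more component,
  hence a factor \<open>x\<close>, while moving it to \<open>S\<close> leaves the components alone.
  Their difference contributes the factor \<open>x - 1\<close>. The set \<open>S\<close> is general
  because the recursion fills it; the case used later is \<open>S = {}\<close>.\<close>

lemma card_mixed_colourings_forest:
  assumes "finite V" "D \<union> S \<subseteq> graph_edges V" "D \<inter> S = {}" "\<nexists>C. is_cycle V (D \<union> S) C"
  shows "(of_nat (card (mixed_colourings (V \<rightarrow>\<^sub>E {1..x}) D S)) :: rat) =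
    of_nat x ^ num_components V (D \<union> S) * (of_nat x - 1) ^ card D"
proof -
  have "finite D" using assms(1,2) finite_graph_edges finite_subset by blast
  then show ?thesis using assms(2-4)
  proof (induction D arbitrary: S rule: finite_induct)
    case empty
    then show ?case using card_edge_constant[OF assms(1), of S x] by simp
  next
    case (insert e D)
    have "e \<in> graph_edges V" using insert.prems(1) by auto
    then obtain u v where e: "e = {u, v}" "u \<noteq> v" by (rule graph_edgesE)
    have un: "insert e D \<union> S = insert e (D \<union> S)" "D \<union> insert e S = insert e (D \<union> S)" by auto
    have "finite (V \<rightarrow>\<^sub>E {1..x})" using \<open>finite V\<close> by (simp add: finite_PiE)
    from card_mixed_colourings_delete[OF this e(2), of D S]
    have "(of_nat (card (mixed_colourings (V \<rightarrow>\<^sub>E {1..x}) (insert e D) S)) :: rat) =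
        of_nat (card (mixed_colourings (V \<rightarrow>\<^sub>E {1..x}) D S)) -
        of_nat (card (mixed_colourings (V \<rightarrow>\<^sub>E {1..x}) D (insert e S)))"
      using e(1) by simp
    also have "(of_nat (card (mixed_colourings (V \<rightarrow>\<^sub>E {1..x}) D (insert e S))) :: rat) =
        of_nat x ^ num_components V (insert e (D \<union> S)) * (of_nat x - 1) ^ card D"
      using insert.IH[of "insert e S"] insert.prems insert.hyps(2) un by auto
    also have "(of_nat (card (mixed_colourings (V \<rightarrow>\<^sub>E {1..x}) D S)) :: rat) =
        of_nat x ^ num_components V (D \<union> S) * (of_nat x - 1) ^ card D"
    proof (rule insert.IH)
      show "\<nexists>C. is_cycle V (D \<union> S) C"
        using insert.prems(3) un(1) is_cycle_mono by (metis subset_insertI)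
    qed (use insert.prems in auto)
    also have "num_components V (D \<union> S) = Suc (num_components V (insert e (D \<union> S)))"
      using insert.prems insert.hyps(2) un
      by (intro num_components_insert_forest[OF assms(1)]) auto
    finally show ?case
      using insert.hyps un by (simp add: algebra_simps)
  qed
qed

section \<open>Disjoint unions of paths\<close>

lemma path_vertices_Sigma: "path_vertices ls = Sigma {..<length ls} (\<lambda>j. {..<ls ! j})"
  by (auto simp: path_vertices_def)

lemma finite_path_vertices: "finite (path_vertices ls)"
  by (simp add: path_vertices_Sigma)

lemma path_edges_subset: "path_edges ls \<subseteq> graph_edges (path_vertices ls)"
  unfolding path_edges_def graph_edges_def path_vertices_def by fastforce

lemma path_edge_eq_iff:
  "{(j, k), (j, Suc k)} = {(j', k'), (j', Suc k')} \<longleftrightarrow> j = j' \<and> k = k'"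
  by (auto simp: doubleton_eq_iff)

lemma path_edgesI: "j < length ls \<Longrightarrow> Suc k < ls ! j \<Longrightarrow> {(j, k), (j, Suc k)} \<in> path_edges ls"
  unfolding path_edges_def by (intro CollectI exI[of _ j] exI[of _ k] conjI) simp_all

lemma path_edgesE:
  assumes "e \<in> path_edges ls"
  obtains j k where "e = {(j, k), (j, Suc k)}" "j < length ls" "Suc k < ls ! j"
  using assms unfolding path_edges_def by auto

lemma finite_path_edges: "finite (path_edges ls)"
  using finite_graph_edges[OF finite_path_vertices] path_edges_subset finite_subset by blast

lemma card_path_edges:
  assumes "\<forall>k\<in>set ls. 0 < k"
  shows "card (path_edges ls) + length ls = card (path_vertices ls)"
proof -
  let ?I = "Sigma {..<length ls} (\<lambda>j. {..<ls ! j - 1})"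
  have "path_edges ls = (\<lambda>(j, k). {(j, k), (j, Suc k)}) ` ?I"
    by (force simp: path_edges_def image_iff)
  moreover have "inj_on (\<lambda>(j, k). {(j, k), (j, Suc k)}) ?I"
    by (rule inj_onI) (clarsimp simp only: path_edge_eq_iff split_conv simp_thms)
  ultimately have "card (path_edges ls) = (\<Sum>j<length ls. ls ! j - 1)"
    by (simp add: card_image)
  then have "card (path_edges ls) + length ls = (\<Sum>j<length ls. (ls ! j - 1) + 1)"
    by (simp only: sum.distrib) simp
  also have "\<dots> = (\<Sum>j<length ls. ls ! j)"
    \<comment> \<open>Positivity of the parts makes the truncated subtraction exact.\<close>
    using assms by (intro sum.cong) (auto simp: Suc_leI)
  finally show ?thesis by (simp add: path_vertices_Sigma)
qed

text \<open>Keeps the deletion recursion among unions of paths: dropping the condition on one edge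
  leaves such a union again, with one path more.\<close>

lemma path_cut:
  assumes "j < length ls" "Suc k < ls ! j" "\<forall>k\<in>set ls. 0 < k"
  obtains ls' g where "bij_betw g (path_vertices ls) (path_vertices ls')"
    "(`) g ` (path_edges ls - {{(j, k), (j, Suc k)}}) = path_edges ls'"
    "length ls' = Suc (length ls)" "\<forall>k\<in>set ls'. 0 < k"
proof -
  let ?n = "length ls"
  \<comment> \<open>The first \<open>Suc k\<close> vertices remain path \<open>j\<close>; the others
    become a new last path with index \<open>?n\<close>, numbered again from 0. The list
    \<open>ls'\<close> need not be decreasing.\<close>
  define ls' where "ls' = ls[j := Suc k] @ [ls ! j - Suc k]"
  define g where "g = (\<lambda>(a, b). if a = j \<and> k < b then (?n, b - Suc k) else (a, b))"
  define h where "h = (\<lambda>(a, b). if a = ?n then (j, b + Suc k) else (a, b))"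
  have len: "length ls' = Suc ?n" by (simp add: ls'_def)
  have nth: "ls' ! i = (if i = ?n then ls ! j - Suc k else if i = j then Suc k else ls ! i)"
    if "i \<le> ?n" for i
    using that assms(1) by (auto simp: ls'_def nth_append nth_list_update)
  have "bij_betw g (path_vertices ls) (path_vertices ls')"
  proof (rule bij_betw_byWitness[where f' = h])
    show "\<forall>p\<in>path_vertices ls. h (g p) = p"
      by (auto simp: path_vertices_def g_def h_def)
    show "\<forall>p\<in>path_vertices ls'. g (h p) = p"
    proof
      fix p assume "p \<in> path_vertices ls'"
      then obtain a b where "p = (a, b)" "a \<le> ?n" "b < ls' ! a"
        using len by (auto simp: path_vertices_def)
      then show "g (h p) = p"
        using assms(1) nth[of a] by (cases "a = ?n"; cases "a = j") (auto simp: g_def h_def)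
    qed
    show "g ` path_vertices ls \<subseteq> path_vertices ls'"
    proof (rule image_subsetI)
      fix p assume "p \<in> path_vertices ls"
      then obtain a b where "p = (a, b)" "a < ?n" "b < ls ! a" by (auto simp: path_vertices_def)
      then show "g p \<in> path_vertices ls'"
        using len nth[of ?n] nth[of a]
        by (cases "a = j \<and> k < b") (auto simp: path_vertices_def g_def)
    qed
    show "h ` path_vertices ls' \<subseteq> path_vertices ls"
    proof (rule image_subsetI)
      fix p assume "p \<in> path_vertices ls'"
      then obtain a b where "p = (a, b)" "a \<le> ?n" "b < ls' ! a"
        using len by (auto simp: path_vertices_def)
      then show "h p \<in> path_vertices ls"
        using assms(1,2) nth[of a]
        by (cases "a = ?n"; cases "a = j") (auto simp: path_vertices_def h_def)
    qed
  qed
  moreover have "(`) g ` (path_edges ls - {{(j, k), (j, Suc k)}}) = path_edges ls'"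
  proof (intro equalityI subsetI)
    fix e' assume "e' \<in> (`) g ` (path_edges ls - {{(j, k), (j, Suc k)}})"
    then obtain e where e: "e' = g ` e" "e \<in> path_edges ls" "e \<noteq> {(j, k), (j, Suc k)}" by blast
    obtain a b where ab: "e = {(a, b), (a, Suc b)}" "a < ?n" "Suc b < ls ! a"
      using e(2) by (rule path_edgesE)
    have ne: "\<not> (a = j \<and> b = k)" using e(3) ab(1) by auto
    show "e' \<in> path_edges ls'"
    proof (cases "a = j \<and> k < b")
      case True
      then have "e' = {(?n, b - Suc k), (?n, Suc (b - Suc k))}"
        using e(1) ab(1) by (auto simp: g_def Suc_diff_Suc)
      moreover have "Suc (b - Suc k) < ls' ! ?n" using True ab(3) nth[of ?n] by auto
      ultimately show ?thesis using path_edgesI[of ?n ls' "b - Suc k"] len by simp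
    next
      case False
      then have "e' = {(a, b), (a, Suc b)}" using e(1) ab(1) ne by (auto simp: g_def)
      moreover have "Suc b < ls' ! a" using False ab ne nth[of a] by auto
      ultimately show ?thesis using path_edgesI[of a ls' b] len ab(2) by simp
    qed
  next
    fix e' assume "e' \<in> path_edges ls'"
    then obtain a b where ab: "e' = {(a, b), (a, Suc b)}" "a < length ls'" "Suc b < ls' ! a"
      by (rule path_edgesE)
    show "e' \<in> (`) g ` (path_edges ls - {{(j, k), (j, Suc k)}})"
    proof (cases "a = ?n")
      case True
      let ?e = "{(j, b + Suc k), (j, Suc (b + Suc k))}"
      have "Suc (b + Suc k) < ls ! j" using True ab(3) nth[of ?n] by simp
      then have "?e \<in> path_edges ls" using assms(1) by (intro path_edgesI)
      moreover have "?e \<noteq> {(j, k), (j, Suc k)}" unfolding path_edge_eq_iff by simp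
      moreover have "e' = g ` ?e" using True ab(1) by (simp add: g_def)
      ultimately show ?thesis by (intro image_eqI[where x = ?e] DiffI) simp_all
    next
      case False
      let ?e = "{(a, b), (a, Suc b)}"
      have a: "a < ?n" using False ab(2) len by simp
      have b: "a = j \<longrightarrow> b < k" "Suc b < ls ! a"
        using a ab(3) nth[of a] assms(2) by (auto split: if_splits)
      have "?e \<in> path_edges ls" using a b(2) by (intro path_edgesI)
      moreover have "?e \<noteq> {(j, k), (j, Suc k)}" unfolding path_edge_eq_iff using b(1) by auto
      moreover have "e' = g ` ?e" using ab(1) b(1) by (auto simp: g_def)
      ultimately show ?thesis by (intro image_eqI[where x = ?e] DiffI) simp_all
    qed
  qed
  moreover have "\<forall>k\<in>set ls'. 0 < k"
    using assms(2,3) set_update_subset_insert[of ls j "Suc k"] by (auto simp: ls'_def)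
  ultimately show ?thesis using that len by blast
qed

text \<open>Cutting paths destroys the order of the parts, whereas the basis is indexed by
  decreasing lists. Permuting the paths is an isomorphism of graphs and restores the order.\<close>

lemma sorted_paths:
  obtains ms g where "mset ms = mset ls" "sorted (rev ms)"
    "bij_betw g (path_vertices ms) (path_vertices ls)" "(`) g ` path_edges ms = path_edges ls"
proof -
  define ms where "ms = rev (sort ls)"
  have mset: "mset ms = mset ls" by (simp add: ms_def)
  have len: "length ms = length ls" by (simp add: ms_def)
  obtain p where p: "bij_betw p {..<length ms} {..<length ls}" "\<forall>i<length ms. ms ! i = ls ! p i"
    using permutation_Ex_bij[OF mset] by auto
  define g where "g = (\<lambda>(j :: nat, k :: nat). (p j, k))"
  have p_img: "p ` {..<length ms} = {..<length ls}" using p(1) by (simp add: bij_betw_def)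
  have "bij_betw g (path_vertices ms) (path_vertices ls)"
    unfolding bij_betw_def
  proof
    show "inj_on g (path_vertices ms)"
    proof (rule inj_onI)
      fix q q' assume "q \<in> path_vertices ms" "q' \<in> path_vertices ms" "g q = g q'"
      then obtain j k j' where "q = (j, k)" "q' = (j', k)" "j < length ms" "j' < length ms" "p j = p j'"
        by (auto simp: path_vertices_def g_def)
      then show "q = q'" using bij_betw_imp_inj_on[OF p(1)] by (auto dest: inj_onD)
    qed
    show "g ` path_vertices ms = path_vertices ls"
    proof (intro equalityI subsetI)
      fix q assume "q \<in> g ` path_vertices ms"
      then show "q \<in> path_vertices ls"
        using p_img p(2) by (auto simp: g_def path_vertices_def)
    next
      fix q assume "q \<in> path_vertices ls"
      then obtain j k where q: "q = (j, k)" "j < length ls" "k < ls ! j"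
        by (auto simp: path_vertices_def)
      then have "j \<in> p ` {..<length ms}" using p_img by simp
      then obtain i where "i < length ms" "p i = j" by auto
      then have "(i, k) \<in> path_vertices ms" "q = g (i, k)"
        using p(2) q by (simp_all add: g_def path_vertices_def)
      then show "q \<in> g ` path_vertices ms" by blast
    qed
  qed
  moreover have "(`) g ` path_edges ms = path_edges ls"
  proof (intro equalityI subsetI)
    fix e assume "e \<in> (`) g ` path_edges ms"
    then obtain e' where e': "e = g ` e'" "e' \<in> path_edges ms" by blast
    obtain j k where jk: "e' = {(j, k), (j, Suc k)}" "j < length ms" "Suc k < ms ! j"
      using e'(2) by (rule path_edgesE)
    have "p j < length ls" "Suc k < ls ! p j" using jk p_img p(2) by auto
    moreover have "e = {(p j, k), (p j, Suc k)}" using e'(1) jk(1) by (simp add: g_def)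
    ultimately show "e \<in> path_edges ls" by (simp add: path_edgesI)
  next
    fix e assume "e \<in> path_edges ls"
    then obtain j k where jk: "e = {(j, k), (j, Suc k)}" "j < length ls" "Suc k < ls ! j"
      by (rule path_edgesE)
    have "j \<in> p ` {..<length ms}" using p_img jk(2) by simp
    then obtain i where i: "i < length ms" "p i = j" by auto
    have "{(i, k), (i, Suc k)} \<in> path_edges ms" using i jk(3) p(2) by (intro path_edgesI) auto
    moreover have "e = g ` {(i, k), (i, Suc k)}" using i(2) jk(1) by (simp add: g_def)
    ultimately show "e \<in> (`) g ` path_edges ms" by blast
  qed
  moreover have "sorted (rev ms)" by (simp add: ms_def)
  ultimately show ?thesis using that[OF mset] by blast
qed

section \<open>The linear map from symmetric functions to numbers\<close>

definition bounded_partitions :: "nat \<Rightarrow> nat list set" where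
  "bounded_partitions N = {ls. is_partition ls \<and> card (path_vertices ls) \<le> N}"

definition path_csf :: "nat list \<Rightarrow> (nat \<Rightarrow> nat) \<Rightarrow> rat" where
  "path_csf ls \<alpha> = of_nat (chrom_coeff (path_vertices ls) (path_edges ls) \<alpha>)"

text \<open>Since the \<open>X\<^bsub>P\<^esub>\<close> form a basis, there is a linear map sending \<open>X\<^bsub>P\<^esub>\<close> for \<open>\<ell>\<close> paths to \<open>t\<^sup>\<ell>\<close>;
  the relation below is its graph, which makes sense before linear independence is known.\<close>
definition path_functional :: "nat \<Rightarrow> rat \<Rightarrow> ((nat \<Rightarrow> nat) \<Rightarrow> rat) \<Rightarrow> rat \<Rightarrow> bool" where
  "path_functional N t f y \<longleftrightarrow> (\<exists>a.
     (\<forall>\<alpha>. f \<alpha> = (\<Sum>ls\<in>bounded_partitions N. a ls * path_csf ls \<alpha>)) \<and>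
     y = (\<Sum>ls\<in>bounded_partitions N. a ls * t ^ length ls))"

text \<open>Every part is at most \<open>N\<close>, and so is the number of parts, since they are
  positive.\<close>

lemma finite_bounded_partitions: "finite (bounded_partitions N)"
proof (rule finite_subset)
  show "bounded_partitions N \<subseteq> {ls. set ls \<subseteq> {..N} \<and> length ls \<le> N}"
  proof
    fix ls assume "ls \<in> bounded_partitions N"
    then have ls: "\<forall>k\<in>set ls. 0 < k" "card (path_vertices ls) \<le> N"
      by (auto simp: bounded_partitions_def is_partition_def)
    have "k \<le> N" if "k \<in> set ls" for k
    proof -
      obtain j where "j < length ls" "ls ! j = k" using \<open>k \<in> set ls\<close> by (auto simp: in_set_conv_nth)
      then have "{j} \<times> {..<k} \<subseteq> path_vertices ls" by (auto simp: path_vertices_def)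
      from card_mono[OF finite_path_vertices this] ls(2) show ?thesis by simp
    qed
    moreover have "length ls \<le> N" using card_path_edges[OF ls(1)] ls(2) by simp
    ultimately show "ls \<in> {ls. set ls \<subseteq> {..N} \<and> length ls \<le> N}" by auto
  qed
qed (simp add: finite_lists_length_le)

lemma path_functional_path_csf:
  assumes "ls \<in> bounded_partitions N"
  shows "path_functional N t (path_csf ls) (t ^ length ls)"
proof -
  have "g ls = (\<Sum>ms\<in>bounded_partitions N. (if ms = ls then 1 else 0) * g ms)" for g :: "nat list \<Rightarrow> rat"
    using assms finite_bounded_partitions by (simp add: if_distrib[of "\<lambda>c. c * _"] cong: if_cong)
  then show ?thesis
    unfolding path_functional_def
    by (intro exI[of _ "\<lambda>ms. if ms = ls then 1 else 0"] conjI allI)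
qed

lemma path_functional_diff:
  assumes "path_functional N t f y" "path_functional N t g z"
  shows "path_functional N t (\<lambda>\<alpha>. f \<alpha> - g \<alpha>) (y - z)"
proof -
  obtain a b where
    "\<forall>\<alpha>. f \<alpha> = (\<Sum>ls\<in>bounded_partitions N. a ls * path_csf ls \<alpha>)"
    "y = (\<Sum>ls\<in>bounded_partitions N. a ls * t ^ length ls)"
    "\<forall>\<alpha>. g \<alpha> = (\<Sum>ls\<in>bounded_partitions N. b ls * path_csf ls \<alpha>)"
    "z = (\<Sum>ls\<in>bounded_partitions N. b ls * t ^ length ls)"
    using assms unfolding path_functional_def by blast
  then show ?thesis
    unfolding path_functional_def
    by (intro exI[of _ "\<lambda>ls. a ls - b ls"]) (simp add: left_diff_distrib sum_subtractf)
qed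

lemma path_functional_sum:
  assumes "\<And>i. i \<in> I \<Longrightarrow> path_functional N t (f i) (y i)"
  shows "path_functional N t (\<lambda>\<alpha>. \<Sum>i\<in>I. c i * f i \<alpha>) (\<Sum>i\<in>I. c i * y i)"
proof -
  have "\<forall>i. \<exists>a. i \<in> I \<longrightarrow> (\<forall>\<alpha>. f i \<alpha> = (\<Sum>ls\<in>bounded_partitions N. a ls * path_csf ls \<alpha>)) \<and>
     y i = (\<Sum>ls\<in>bounded_partitions N. a ls * t ^ length ls)"
    using assms unfolding path_functional_def by blast
  then obtain a where a:
    "\<And>i \<alpha>. i \<in> I \<Longrightarrow> f i \<alpha> = (\<Sum>ls\<in>bounded_partitions N. a i ls * path_csf ls \<alpha>)"
    "\<And>i. i \<in> I \<Longrightarrow> y i = (\<Sum>ls\<in>bounded_partitions N. a i ls * t ^ length ls)"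
    by metis
  have *: "(\<Sum>i\<in>I. c i * (\<Sum>ls\<in>bounded_partitions N. a i ls * g ls)) =
      (\<Sum>ls\<in>bounded_partitions N. (\<Sum>i\<in>I. c i * a i ls) * g ls)" for g
    unfolding sum_distrib_left sum_distrib_right mult.assoc by (rule sum.swap)
  show ?thesis
    unfolding path_functional_def
    by (intro exI[of _ "\<lambda>ls. \<Sum>i\<in>I. c i * a i ls"] conjI allI) (simp_all add: a flip: *)
qed

text \<open>Induction on the number of monochromatic edges. Colourings with equal ends of an edge
  are those without a condition on it, where the path is cut and a factor \<open>t\<close> appears,
  minus those with distinct ends. Each such edge therefore contributes \<open>t - 1\<close>.\<close>

lemma path_functional_mixed_paths:
  assumes "\<forall>k\<in>set ls. 0 < k" "card (path_vertices ls) \<le> N" "S \<subseteq> path_edges ls"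
  shows "path_functional N t
    (\<lambda>\<alpha>. of_nat (card (mixed_colourings (content_maps (path_vertices ls) \<alpha>) (path_edges ls - S) S)))
    (t ^ length ls * (t - 1) ^ card S)"
proof -
  show ?thesis using assms
  proof (induction "card S" arbitrary: ls S)
    case 0
    then have S: "S = {}" using finite_path_edges finite_subset by fastforce
    \<comment> \<open>Without monochromatic edges this is \<open>X\<close> of a union of paths, and
      sorting the paths makes it a basis element.\<close>
    obtain ms g where ms: "mset ms = mset ls" "sorted (rev ms)"
        "bij_betw g (path_vertices ms) (path_vertices ls)" "(`) g ` path_edges ms = path_edges ls"
      by (rule sorted_paths)
    have "card (path_vertices ms) = card (path_vertices ls)" using ms(3) by (rule bij_betw_same_card)
    moreover have "set ms = set ls" using ms(1) by (metis set_mset_mset)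
    ultimately have "ms \<in> bounded_partitions N"
      using "0.prems" ms(2) by (simp add: bounded_partitions_def is_partition_def)
    moreover have "length ms = length ls" using ms(1) by (metis size_mset)
    moreover have "path_csf ms =
        (\<lambda>\<alpha>. of_nat (card (mixed_colourings (content_maps (path_vertices ls) \<alpha>) (path_edges ls) {})))"
      using card_mixed_colourings_iso[OF ms(3) path_edges_subset, of "{}"] ms(4)
      by (simp add: path_csf_def chrom_coeff_eq fun_eq_iff)
    ultimately show ?case using path_functional_path_csf[of ms N t] S by simp
  next
    case (Suc n T)
    then obtain e S where eS: "T = insert e S" "e \<notin> S" "card S = n"
      using card_Suc_eq[of T n] Suc.hyps(2) by metis
    have prems: "\<forall>k\<in>set ls. 0 < k" "card (path_vertices ls) \<le> N" "insert e S \<subseteq> path_edges ls"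
      using Suc.prems eS(1) by simp_all
    then have "e \<in> path_edges ls" by simp
    then obtain j k where jk: "j < length ls" "Suc k < ls ! j" "e = {(j, k), (j, Suc k)}"
      by (metis path_edgesE)
    obtain ls' g where cut: "bij_betw g (path_vertices ls) (path_vertices ls')"
        "(`) g ` (path_edges ls - {e}) = path_edges ls'"
        "length ls' = Suc (length ls)" "\<forall>k\<in>set ls'. 0 < k"
      by (rule path_cut[OF jk(1,2) prems(1), folded jk(3)])
    let ?S' = "(`) g ` S"
    have inj: "inj_on ((`) g) (path_edges ls)"
    proof (rule inj_on_subset[OF inj_on_image_Pow])
      show "inj_on g (path_vertices ls)" using cut(1) by (rule bij_betw_imp_inj_on)
      show "path_edges ls \<subseteq> Pow (path_vertices ls)"
        using path_edges_subset[of ls] by (auto simp: graph_edges_def)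
    qed
    have sub: "S \<subseteq> path_edges ls - {e}" using prems(3) eS(2) by auto
    have card: "card ?S' = card S"
      using sub by (intro card_image inj_on_subset[OF inj]) auto
    have diff: "(`) g ` (path_edges ls - insert e S) = path_edges ls' - ?S'"
    proof -
      have "path_edges ls - insert e S = (path_edges ls - {e}) - S" by auto
      moreover have "(`) g ` ((path_edges ls - {e}) - S) = (`) g ` (path_edges ls - {e}) - ?S'"
        by (rule inj_on_image_set_diff[OF inj]) (use sub in auto)
      ultimately show ?thesis by (simp only: cut(2))
    qed
    have edges: "path_edges ls - insert e S \<subseteq> graph_edges (path_vertices ls)"
        "S \<subseteq> graph_edges (path_vertices ls)"
      using path_edges_subset[of ls] prems(3) by auto
    let ?m = "\<lambda>ls S \<alpha>. card (mixed_colourings (content_maps (path_vertices ls) \<alpha>) (path_edges ls - S) S)"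
    have "path_edges ls - S = insert e (path_edges ls - insert e S)"
      using prems(3) eS(2) by auto
    \<comment> \<open>The colourings of the cut paths are those of \<open>ls\<close> with no
      condition on \<open>e\<close>; they split by whether the ends of \<open>e\<close>
      agree.\<close>
    then have "?m ls' ?S' \<alpha> = ?m ls (insert e S) \<alpha> + ?m ls S \<alpha>" for \<alpha>
      using card_mixed_colourings_delete[OF finite_content_maps[OF finite_path_vertices[of ls]],
          of "(j, k)" "(j, Suc k)" \<alpha> "path_edges ls - insert e S" S, folded jk(3)]
        card_mixed_colourings_iso[OF cut(1) edges, of \<alpha>, unfolded diff]
      by simp
    then have recurrence:
      "(of_nat (?m ls (insert e S) \<alpha>) :: rat) = of_nat (?m ls' ?S' \<alpha>) - of_nat (?m ls S \<alpha>)" for \<alpha>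
      by (simp only: of_nat_add add_diff_cancel_right')
    have "path_functional N t (\<lambda>\<alpha>. of_nat (?m ls S \<alpha>)) (t ^ length ls * (t - 1) ^ card S)"
    proof (rule Suc.hyps(1))
      show "S \<subseteq> path_edges ls" using sub by auto
    qed (use eS(3) prems in simp_all)
    moreover have "path_functional N t (\<lambda>\<alpha>. of_nat (?m ls' ?S' \<alpha>))
      (t ^ length ls' * (t - 1) ^ card ?S')"
    proof (rule Suc.hyps(1))
      show "?S' \<subseteq> path_edges ls'" using sub cut(2) by blast
      show "card (path_vertices ls') \<le> N" using prems(2) bij_betw_same_card[OF cut(1)] by simp
    qed (use card eS(3) cut(4) in simp_all)
    ultimately have "path_functional N t (\<lambda>\<alpha>. of_nat (?m ls (insert e S) \<alpha>))
        (t ^ length ls' * (t - 1) ^ card ?S' - t ^ length ls * (t - 1) ^ card S)"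
      unfolding recurrence by (rule path_functional_diff[rotated])
    moreover have "t ^ length ls' * (t - 1) ^ card ?S' - t ^ length ls * (t - 1) ^ card S =
        t ^ length ls * (t - 1) ^ card T"
      unfolding cut(3) card eS(3) Suc.hyps(2)[symmetric] by (simp add: algebra_simps)
    ultimately show ?case by (simp only: eS(1))
  qed
qed

section \<open>Power sums of forests realised on paths\<close>

lemma edge_constant_path:
  assumes "edge_constant (path_edges ls) \<kappa>" "j < length ls" "k < ls ! j"
  shows "\<kappa> (j, k) = \<kappa> (j, 0)"
  using assms(3)
proof (induction k)
  case (Suc k)
  then have "{(j, k), (j, Suc k)} \<in> path_edges ls" using assms(2) by (intro path_edgesI)
  then have "\<kappa> (j, k) = \<kappa> (j, Suc k)" using assms(1) unfolding edge_constant_def by blast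
  then show ?case using Suc by simp
qed simp

text \<open>The vertices of each component are listed in arbitrary order as a path. The bijection
  \<open>f\<close> need not respect edges, but being constant on edges depends only on the partition
  into components, and \<open>f\<close> respects that.\<close>

lemma components_as_paths:
  assumes "finite V" "F \<subseteq> graph_edges V"
  obtains ms f where "\<forall>k\<in>set ms. 0 < k" "length ms = num_components V F"
    "bij_betw f (path_vertices ms) V"
    "\<And>\<kappa>. edge_constant (path_edges ms) (restrict (\<kappa> \<circ> f) (path_vertices ms)) \<longleftrightarrow> edge_constant F \<kappa>"
proof -
  let ?R = "(adj_rel F)\<^sup>*"
  have eq: "equiv UNIV ?R" by (rule equiv_adj_rel_rtrancl)
  have "finite (V // ?R)" using \<open>finite V\<close> by (simp add: quotient_def)
  then obtain Bs where Bs: "set Bs = V // ?R" "distinct Bs" using finite_distinct_list by blast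
  have sub: "B \<subseteq> V" if "B \<in> V // ?R" for B
    using that adj_rel_rtrancl_closed[OF _ assms(2)] by (auto elim!: quotientE)
  have "\<exists>l. set l = B \<and> distinct l" if "B \<in> V // ?R" for B
    using sub[OF that] \<open>finite V\<close> finite_distinct_list finite_subset by metis
  then obtain l where l: "\<And>B. B \<in> V // ?R \<Longrightarrow> set (l B) = B \<and> distinct (l B)" by metis
  define ms where "ms = map (\<lambda>B. length (l B)) Bs"
  define f where "f = (\<lambda>(j, k). l (Bs ! j) ! k)"
  have len: "length ms = length Bs" by (simp add: ms_def)
  have nth: "ms ! j = length (l (Bs ! j))" if "j < length Bs" for j
    using that by (simp add: ms_def)
  have cls: "Bs ! j \<in> V // ?R" if "j < length Bs" for j
    using that Bs(1) nth_mem by blast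
  have pv: "(j, k) \<in> path_vertices ms \<longleftrightarrow> j < length Bs \<and> k < length (l (Bs ! j))" for j k
    using len nth by (auto simp: path_vertices_def)
  have mem: "f (j, k) \<in> Bs ! j" if "(j, k) \<in> path_vertices ms" for j k
    using that l[OF cls[of j]] nth_mem[of k "l (Bs ! j)"] by (simp add: f_def pv)
  have related: "(a, b) \<in> ?R" if "a \<in> X" "b \<in> X" "X \<in> V // ?R" for a b X
  proof -
    obtain w where "X = ?R `` {w}" using \<open>X \<in> V // ?R\<close> by (auto elim!: quotientE)
    then have "(w, a) \<in> ?R" "(w, b) \<in> ?R" using that by auto
    then show ?thesis using eq by (meson equivE symD transD)
  qed
  have same: "j = j'" if "a \<in> Bs ! j" "b \<in> Bs ! j'" "(a, b) \<in> ?R" "j < length Bs" "j' < length Bs"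
    for j j' a b
  proof -
    have "Bs ! j \<in> UNIV // ?R" "Bs ! j' \<in> UNIV // ?R"
      using cls that by (auto simp: quotient_def)
    then have "Bs ! j = Bs ! j'" using quotient_eq_iff[OF eq] that by blast
    then show ?thesis using Bs(2) that nth_eq_iff_index_eq by blast
  qed
  have bij: "bij_betw f (path_vertices ms) V"
    unfolding bij_betw_def
  proof
    show "inj_on f (path_vertices ms)"
    proof (rule inj_onI)
      fix p q assume p: "p \<in> path_vertices ms" and q: "q \<in> path_vertices ms" and fpq: "f p = f q"
      obtain j k j' k' where jk: "p = (j, k)" "q = (j', k')" by (cases p, cases q)
      have "f p \<in> Bs ! j" "f q \<in> Bs ! j'" using mem p q jk by auto
      then have "j = j'" using fpq p q jk pv by (intro same[of "f p" j "f q" j']) auto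
      moreover from this have "k = k'"
        using p q fpq l[OF cls[of j]] by (auto simp: jk pv f_def nth_eq_iff_index_eq)
      ultimately show "p = q" using jk by simp
    qed
    show "f ` path_vertices ms = V"
    proof (intro equalityI subsetI)
      fix v assume "v \<in> f ` path_vertices ms"
      then obtain j k where "(j, k) \<in> path_vertices ms" "v = f (j, k)" by auto
      then show "v \<in> V" using mem sub cls pv by blast
    next
      fix v assume "v \<in> V"
      then have "?R `` {v} \<in> set Bs" using Bs(1) by (simp add: quotientI)
      then obtain j where j: "j < length Bs" "Bs ! j = ?R `` {v}" by (auto simp: in_set_conv_nth)
      then have "v \<in> Bs ! j" by simp
      then have "v \<in> set (l (Bs ! j))" using l[OF cls[OF j(1)]] by blast
      then obtain k where "k < length (l (Bs ! j))" "l (Bs ! j) ! k = v"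
        by (auto simp: in_set_conv_nth)
      then have "(j, k) \<in> path_vertices ms" "v = f (j, k)" using j(1) by (simp_all add: pv f_def)
      then show "v \<in> f ` path_vertices ms" by (rule rev_image_eqI)
    qed
  qed
  have const: "edge_constant (path_edges ms) (restrict (\<kappa> \<circ> f) (path_vertices ms)) \<longleftrightarrow> edge_constant F \<kappa>"
    for \<kappa> :: "'a \<Rightarrow> nat"
  proof
    let ?\<kappa> = "restrict (\<kappa> \<circ> f) (path_vertices ms)"
    assume c: "edge_constant (path_edges ms) ?\<kappa>"
    have class_const: "\<kappa> (f (j, k)) = \<kappa> (f (j, k'))"
      if "(j, k) \<in> path_vertices ms" "(j, k') \<in> path_vertices ms" for j k k'
    proof -
      have "?\<kappa> (j, k) = ?\<kappa> (j, k')"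
        using edge_constant_path[OF c, of j] that len nth[of j] by (simp add: pv)
      then show ?thesis using that by simp
    qed
    have "\<kappa> u = \<kappa> v" if uv: "(u, v) \<in> ?R" for u v
    proof (cases "u \<in> V")
      case True
      then have "v \<in> V" using adj_rel_rtrancl_closed[OF uv assms(2)] by simp
      then obtain j k j' k' where jk: "(j, k) \<in> path_vertices ms" "u = f (j, k)"
        "(j', k') \<in> path_vertices ms" "v = f (j', k')"
        using True bij unfolding bij_betw_def by (metis imageE surj_pair)
      then have j: "j = j'" using same[OF mem mem, of j k j' k'] uv pv by simp
      have "\<kappa> (f (j, k)) = \<kappa> (f (j, k'))"
        by (rule class_const[OF jk(1)]) (simp only: j jk(3))
      then show ?thesis by (simp only: jk(2,4) j)
    next
      case False
      \<comment> \<open>No edge leaves \<open>V\<close>, so a point outside \<open>V\<close> is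
        related only to itself.\<close>
      have "(v, u) \<in> ?R" using uv eq by (meson equivE symD)
      then show ?thesis
      proof (cases rule: converse_rtranclE)
        case (step w)
        then have "v \<in> V" using assms(2) by (auto simp: adj_rel_def graph_edges_def doubleton_eq_iff)
        then show ?thesis using adj_rel_rtrancl_closed[OF \<open>(v, u) \<in> ?R\<close> assms(2)] False by simp
      qed simp
    qed
    then show "edge_constant F \<kappa>" by (auto simp: edge_constant_iff_components[OF assms(2)])
  next
    assume c: "edge_constant F \<kappa>"
    show "edge_constant (path_edges ms) (restrict (\<kappa> \<circ> f) (path_vertices ms))"
      unfolding edge_constant_def
    proof (intro ballI)
      fix e p q assume "e \<in> path_edges ms" and p: "p \<in> e" and q: "q \<in> e"
      then obtain j k where jk: "e = {(j, k), (j, Suc k)}" "j < length ms" "Suc k < ms ! j"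
        by (metis path_edgesE)
      then have e: "e \<subseteq> path_vertices ms" by (auto simp: path_vertices_def)
      obtain k' k'' where kk: "p = (j, k')" "q = (j, k'')" using p q jk(1) by auto
      have "(f p, f q) \<in> ?R"
        using related[OF mem mem cls] p q e jk(2) len unfolding kk by auto
      then have "\<kappa> (f p) = \<kappa> (f q)"
        using c unfolding edge_constant_iff_components[OF assms(2)] by blast
      moreover have "p \<in> path_vertices ms" "q \<in> path_vertices ms" using e p q by auto
      ultimately show "restrict (\<kappa> \<circ> f) (path_vertices ms) p = restrict (\<kappa> \<circ> f) (path_vertices ms) q"
        by simp
    qed
  qed
  have "\<forall>k\<in>set ms. 0 < k"
  proof
    fix k assume "k \<in> set ms"
    then obtain B where B: "B \<in> V // ?R" "k = length (l B)" using Bs(1) by (auto simp: ms_def)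
    then have "B \<noteq> {}" by (auto elim!: quotientE)
    then show "0 < k" using l[OF B(1)] B(2) by auto
  qed
  moreover have "length ms = num_components V F"
    using len Bs distinct_card[OF Bs(2)] by (simp add: num_components_def)
  ultimately show ?thesis using that bij const by blast
qed

text \<open>Paths on the component sizes of \<open>F\<close> have as many vertices and components as
  the forest \<open>F\<close>, hence as many edges. With all of these edges monochromatic, the
  exponents are those of \<open>card_mixed_colourings_forest\<close> with
  \<open>S = {}\<close>.\<close>

lemma path_functional_forest:
  assumes "finite V" "F \<subseteq> graph_edges V" "\<nexists>C. is_cycle V F C"
  shows "path_functional (card V) t
    (\<lambda>\<alpha>. of_nat (card (mixed_colourings (content_maps V \<alpha>) {} F)))
    (t ^ num_components V F * (t - 1) ^ card F)"
proof -
  obtain ms f where ms: "\<forall>k\<in>set ms. 0 < k" "length ms = num_components V F"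
    "bij_betw f (path_vertices ms) V"
    "\<And>\<kappa>. edge_constant (path_edges ms) (restrict (\<kappa> \<circ> f) (path_vertices ms)) \<longleftrightarrow> edge_constant F \<kappa>"
    using components_as_paths[OF assms(1,2)] by blast
  have card: "card (path_vertices ms) = card V" using ms(3) by (rule bij_betw_same_card)
  then have "card (path_edges ms) = card F"
    using card_path_edges[OF ms(1)] num_components_forest[OF assms] ms(2) by simp
  moreover have "card (mixed_colourings (content_maps (path_vertices ms) \<alpha>) {} (path_edges ms)) =
      card (mixed_colourings (content_maps V \<alpha>) {} F)" for \<alpha>
    unfolding mixed_colourings_def
    by (rule card_content_maps_reindex[OF ms(3)]) (simp add: ms(4) proper_colouring_def)
  ultimately show ?thesis
    using path_functional_mixed_paths[OF ms(1), of "card V" "path_edges ms" t] card ms(2) by simp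
qed

section \<open>Linear independence\<close>

text \<open>The product of the power sums indexed by the parts: a colouring constant on each path
  selects one variable for each factor.\<close>

definition power_sum_csf :: "nat list \<Rightarrow> (nat \<Rightarrow> nat) \<Rightarrow> rat" where
  "power_sum_csf ls \<alpha> =
    of_nat (card (mixed_colourings (content_maps (path_vertices ls) \<alpha>) {} (path_edges ls)))"

text \<open>The exponent vector of the monomial whose variable number \<open>i\<close> has the
  \<open>i\<close>-th part as exponent. Colours start at 1 and list positions at 0.\<close>

definition partition_content :: "nat list \<Rightarrow> nat \<Rightarrow> nat" where
  "partition_content ms i = (if i \<in> {1..length ms} then ms ! (i - 1) else 0)"

text \<open>The diagonal of a triangular system: giving each path its own colour realises the
  monomial.\<close>

lemma power_sum_csf_content_self: "power_sum_csf ms (partition_content ms) \<noteq> 0"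
proof -
  let ?\<kappa> = "restrict (\<lambda>(j, k). Suc j) (path_vertices ms)"
  have "card {v \<in> path_vertices ms. ?\<kappa> v = i} = partition_content ms i" for i
  proof -
    have "{v \<in> path_vertices ms. ?\<kappa> v = i} =
        (if i \<in> {1..length ms} then {i - 1} \<times> {..<ms ! (i - 1)} else {})"
      by (auto simp: path_vertices_def)
    then show ?thesis by (simp add: partition_content_def card_cartesian_product)
  qed
  then have "?\<kappa> \<in> content_maps (path_vertices ms) (partition_content ms)"
    by (auto simp: content_maps_def)
  moreover have "edge_constant (path_edges ms) ?\<kappa>"
    unfolding edge_constant_def
  proof (intro ballI)
    fix e p q assume "e \<in> path_edges ms" "p \<in> e" "q \<in> e"
    moreover from this obtain j k where "e = {(j, k), (j, Suc k)}" "j < length ms" "Suc k < ms ! j"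
      by (metis path_edgesE)
    ultimately show "?\<kappa> p = ?\<kappa> q" by (auto simp: path_vertices_def)
  qed
  ultimately have "?\<kappa> \<in> mixed_colourings (content_maps (path_vertices ms) (partition_content ms)) {} (path_edges ms)"
    by (simp add: mixed_colourings_def proper_colouring_def)
  moreover have "finite (mixed_colourings (content_maps (path_vertices ms) (partition_content ms)) {} (path_edges ms))"
    using finite_content_maps[OF finite_path_vertices] by (simp add: mixed_colourings_def)
  ultimately show ?thesis unfolding power_sum_csf_def by (auto simp: card_eq_0_iff)
qed

text \<open>Triangularity with respect to length. A contributing colouring merges the parts of
  \<open>ls\<close> by colour into the parts of \<open>ms\<close>, so it maps the paths onto the
  colours in use. For equal lengths nothing is merged, and the two sorted lists have the same
  parts.\<close>

lemma power_sum_csf_content: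
  assumes ls: "is_partition ls" and ms: "is_partition ms"
    and nz: "power_sum_csf ls (partition_content ms) \<noteq> 0"
  shows "length ms \<le> length ls \<and> (length ls = length ms \<longrightarrow> ls = ms)"
proof -
  have "mixed_colourings (content_maps (path_vertices ls) (partition_content ms)) {} (path_edges ls) \<noteq> {}"
    using nz by (auto simp: power_sum_csf_def)
  then obtain \<kappa> where \<kappa>: "\<kappa> \<in> content_maps (path_vertices ls) (partition_content ms)"
      "edge_constant (path_edges ls) \<kappa>"
    by (auto simp: mixed_colourings_def)
  define g where "g = (\<lambda>j. \<kappa> (j, 0))"
  have \<kappa>_eq: "\<kappa> (j, k) = g j" if "j < length ls" "k < ls ! j" for j k
    unfolding g_def using edge_constant_path[OF \<kappa>(2) that] .
  have content: "partition_content ms i = (\<Sum>j\<in>{j. j < length ls \<and> g j = i}. ls ! j)" for i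
  proof -
    have "{v \<in> path_vertices ls. \<kappa> v = i} = Sigma {j. j < length ls \<and> g j = i} (\<lambda>j. {..<ls ! j})"
      by (auto simp: path_vertices_def \<kappa>_eq)
    moreover have "partition_content ms i = card {v \<in> path_vertices ls. \<kappa> v = i}"
      using \<kappa>(1) by (simp add: content_maps_def)
    ultimately show ?thesis by simp
  qed
  have pos: "0 < ls ! j" if "j < length ls" for j using ls that by (simp add: is_partition_def)
  have img: "g ` {..<length ls} = {1..length ms}"
  proof (intro equalityI subsetI)
    fix i assume "i \<in> g ` {..<length ls}"
    then obtain j where j: "j < length ls" "g j = i" by auto
    then have "ls ! j \<le> partition_content ms i"
      unfolding content by (intro member_le_sum) auto
    then show "i \<in> {1..length ms}" using pos[OF j(1)] by (auto simp: partition_content_def split: if_splits)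
  next
    fix i assume i: "i \<in> {1..length ms}"
    then have "0 < partition_content ms i" using ms by (auto simp: partition_content_def is_partition_def)
    then have "{j. j < length ls \<and> g j = i} \<noteq> {}" unfolding content by (metis sum.empty less_irrefl)
    then show "i \<in> g ` {..<length ls}" by auto
  qed
  have "length ms \<le> length ls"
    using card_image_le[of "{..<length ls}" g] img by simp
  moreover have "ls = ms" if len: "length ls = length ms"
  proof -
    have inj: "inj_on g {..<length ls}"
      using img len by (intro eq_card_imp_inj_on) simp_all
    have nth: "ls ! j = ms ! (g j - 1)" if j: "j < length ls" for j
    proof -
      have "{j'. j' < length ls \<and> g j' = g j} = {j}" using inj j by (auto dest: inj_onD)
      then have "partition_content ms (g j) = ls ! j" using content[of "g j"] by simp
      moreover have "g j \<in> {1..length ms}" using img j by blast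
      ultimately show ?thesis by (simp add: partition_content_def)
    qed
    \<comment> \<open>The bijection \<open>g\<close> onto the colours matches the parts of the two
      lists; \<open>Suc\<close> and \<open>i - 1\<close> translate between colours and list
      positions.\<close>
    have "mset ls = image_mset ((!) ls) (mset_set {..<length ls})"
      by (metis map_nth mset_map mset_upt atLeast0LessThan)
    also have "\<dots> = image_mset (\<lambda>i. ms ! (i - 1)) (image_mset g (mset_set {..<length ls}))"
      unfolding multiset.map_comp by (intro image_mset_cong) (simp add: nth)
    also have "image_mset g (mset_set {..<length ls}) = mset_set (Suc ` {..<length ms})"
      using image_mset_mset_set[OF inj] img by (simp add: image_Suc_lessThan)
    also have "\<dots> = image_mset Suc (mset_set {..<length ms})"
      by (simp add: image_mset_mset_set)
    also have "image_mset (\<lambda>i. ms ! (i - 1)) \<dots> = image_mset ((!) ms) (mset_set {..<length ms})"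
      unfolding multiset.map_comp by (simp add: comp_def)
    also have "\<dots> = mset ms"
      by (metis map_nth mset_map mset_upt atLeast0LessThan)
    finally have "mset (rev ls) = mset (rev ms)" by simp
    moreover have "sorted (rev ls)" "sorted (rev ms)" using ls ms by (simp_all add: is_partition_def)
    ultimately have "rev ls = rev ms" by (metis properties_for_sort)
    then show ?thesis by simp
  qed
  ultimately show ?thesis by blast
qed

text \<open>Among the indices with nonzero coefficient let \<open>ms\<close> be one of greatest
  length. By triangularity no other such index contributes to the monomial of
  \<open>ms\<close>.\<close>

lemma power_sum_csf_independent:
  assumes "finite I" "\<forall>ls\<in>I. is_partition ls"
    and zero: "\<And>\<alpha>. (\<Sum>ls\<in>I. b ls * power_sum_csf ls \<alpha>) = 0" and "ls \<in> I"
  shows "b ls = 0"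
proof (rule ccontr)
  assume "b ls \<noteq> 0"
  let ?J = "{ls \<in> I. b ls \<noteq> 0}"
  have "finite ?J" "?J \<noteq> {}" using assms \<open>b ls \<noteq> 0\<close> by auto
  then have "Max (length ` ?J) \<in> length ` ?J" by (intro Max_in) auto
  then obtain ms where ms: "ms \<in> ?J" "length ms = Max (length ` ?J)" by auto
  have max: "length ls \<le> length ms" if "ls \<in> ?J" for ls
    using that \<open>finite ?J\<close> ms(2) by simp
  have "(\<Sum>ls\<in>I. b ls * power_sum_csf ls (partition_content ms)) =
      (\<Sum>ls\<in>{ms}. b ls * power_sum_csf ls (partition_content ms))"
  proof (rule sum.mono_neutral_right[OF assms(1)])
    show "\<forall>ls\<in>I - {ms}. b ls * power_sum_csf ls (partition_content ms) = 0"
    proof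
      fix ls assume ls: "ls \<in> I - {ms}"
      show "b ls * power_sum_csf ls (partition_content ms) = 0"
      proof (rule ccontr)
        assume "b ls * power_sum_csf ls (partition_content ms) \<noteq> 0"
        then have "ls \<in> ?J" "power_sum_csf ls (partition_content ms) \<noteq> 0" using ls by auto
        with max[OF this(1)] power_sum_csf_content[of ls ms] assms(2) ms(1) ls show False by auto
      qed
    qed
  qed (use ms(1) in simp)
  then show False using zero ms(1) power_sum_csf_content_self by simp
qed

lemma sum_fun_apply: "(\<Sum>i\<in>A. f i) x = (\<Sum>i\<in>A. f i x)"
  for f :: "'i \<Rightarrow> 'b \<Rightarrow> 'c::comm_monoid_add"
  by (induction A rule: infinite_finite_induct) auto

text \<open>The \<open>X\<^bsub>P\<^esub>\<close> span the power sums, of which there are as many, and these are independent.\<close>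
lemma path_csf_independent:
  assumes zero: "\<And>\<alpha>. (\<Sum>ls\<in>bounded_partitions N. a ls * path_csf ls \<alpha>) = 0"
    and ms: "ms \<in> bounded_partitions N"
  shows "a ms = 0"
proof (rule ccontr)
  assume nz: "a ms \<noteq> 0"
  let ?I = "bounded_partitions N"
  let ?scale = "\<lambda>(c :: rat) (f :: (nat \<Rightarrow> nat) \<Rightarrow> rat) \<alpha>. c * f \<alpha>"
  interpret fs: vector_space ?scale
    by unfold_locales (auto simp: fun_eq_iff algebra_simps)
  have fin: "finite ?I" by (rule finite_bounded_partitions)
  have part: "\<forall>ls\<in>?I. is_partition ls" by (simp add: bounded_partitions_def)
  let ?T = "path_csf ` (?I - {ms})"
  \<comment> \<open>A nontrivial relation expresses one generator by the others, so fewer than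
    \<open>card ?I\<close> functions span the same space.\<close>
  have "path_csf ms = (\<Sum>ls\<in>?I - {ms}. ?scale (- a ls / a ms) (path_csf ls))"
  proof
    fix \<alpha>
    have "a ms * path_csf ms \<alpha> + (\<Sum>ls\<in>?I - {ms}. a ls * path_csf ls \<alpha>) = 0"
      using zero[of \<alpha>] sum.remove[OF fin ms, of "\<lambda>ls. a ls * path_csf ls \<alpha>"] by simp
    then have "path_csf ms \<alpha> = - (\<Sum>ls\<in>?I - {ms}. a ls * path_csf ls \<alpha>) / a ms"
      using nz by (simp add: field_simps add_eq_0_iff)
    also have "\<dots> = (\<Sum>ls\<in>?I - {ms}. (- a ls / a ms) * path_csf ls \<alpha>)"
      by (simp add: sum_divide_distrib sum_negf)
    finally show "path_csf ms \<alpha> = (\<Sum>ls\<in>?I - {ms}. ?scale (- a ls / a ms) (path_csf ls)) \<alpha>"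
      by (simp add: sum_fun_apply)
  qed
  moreover have "(\<Sum>ls\<in>?I - {ms}. ?scale (- a ls / a ms) (path_csf ls)) \<in> fs.span ?T"
    by (intro fs.span_sum fs.span_scale fs.span_base imageI)
  ultimately have csf_span: "path_csf ls \<in> fs.span ?T" if "ls \<in> ?I" for ls
    using that by (cases "ls = ms") (auto intro: fs.span_base)
  have span: "power_sum_csf ` ?I \<subseteq> fs.span ?T"
  proof (rule image_subsetI)
    fix ls assume ls: "ls \<in> ?I"
    \<comment> \<open>Only the expansion of the power sum in the \<open>path_csf\<close> is
      extracted here, so 0 is an arbitrary choice of \<open>t\<close>.\<close>
    then have "path_functional N 0 (power_sum_csf ls) (0 ^ length ls * (0 - 1) ^ card (path_edges ls))"
      using path_functional_mixed_paths[of ls N "path_edges ls" 0]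
      by (auto simp: bounded_partitions_def is_partition_def power_sum_csf_def[abs_def])
    then obtain c where "\<And>\<alpha>. power_sum_csf ls \<alpha> = (\<Sum>ls\<in>?I. c ls * path_csf ls \<alpha>)"
      unfolding path_functional_def by blast
    then have "power_sum_csf ls = (\<Sum>ls\<in>?I. ?scale (c ls) (path_csf ls))"
      by (simp add: fun_eq_iff sum_fun_apply)
    then show "power_sum_csf ls \<in> fs.span ?T"
      using csf_span by (simp only:) (intro fs.span_sum fs.span_scale)
  qed
  \<comment> \<open>Ensures that the image has as many elements as \<open>?I\<close>: two equal
    power sums would give a relation with coefficients 1 and -1.\<close>
  have inj: "inj_on power_sum_csf ?I"
  proof (rule inj_onI, rule ccontr)
    fix k l assume kl: "k \<in> ?I" "l \<in> ?I" "power_sum_csf k = power_sum_csf l" "k \<noteq> l"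
    let ?b = "\<lambda>i. if i = k then 1 else if i = l then -1 else (0 :: rat)"
    have "(\<Sum>i\<in>?I. ?b i * power_sum_csf i \<alpha>) = 0" for \<alpha>
    proof -
      have "(\<Sum>i\<in>?I. ?b i * power_sum_csf i \<alpha>) = (\<Sum>i\<in>{k, l}. ?b i * power_sum_csf i \<alpha>)"
        by (rule sum.mono_neutral_right) (use fin kl in auto)
      then show ?thesis using kl by simp
    qed
    from power_sum_csf_independent[OF fin part this kl(1)] show False by simp
  qed
  have "\<not> fs.dependent (power_sum_csf ` ?I)"
  proof (rule fs.independent_if_scalars_zero)
    fix f x assume sum: "(\<Sum>x\<in>power_sum_csf ` ?I. ?scale (f x) x) = 0" and "x \<in> power_sum_csf ` ?I"
    then obtain l where l: "l \<in> ?I" "x = power_sum_csf l" by auto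
    have "(\<Sum>i\<in>?I. f (power_sum_csf i) * power_sum_csf i \<alpha>) = 0" for \<alpha>
      using fun_cong[OF sum, of \<alpha>] by (simp add: sum.reindex[OF inj] sum_fun_apply)
    from power_sum_csf_independent[OF fin part this l(1)] show "f x = 0" using l(2) by simp
  qed (use fin in simp)
  \<comment> \<open>An independent set cannot have more elements than a finite set spanning
    it.\<close>
  then have "card (power_sum_csf ` ?I) \<le> card ?T"
    using fs.independent_span_bound[OF _ _ span] fin by blast
  also have "\<dots> \<le> card (?I - {ms})" using fin by (intro card_image_le) simp
  also have "\<dots> < card ?I" using fin ms by (rule card_Diff1_less)
  finally show False using card_image[OF inj] by simp
qed

section \<open>Uniqueness of the expansion and evaluation of \<open>tau\<close>\<close>

lemma path_expansion_sum:
  assumes "path_expansion V E a" "{ls. a ls \<noteq> 0} \<subseteq> bounded_partitions N"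
  shows "of_nat (chrom_coeff V E \<alpha>) = (\<Sum>ls\<in>bounded_partitions N. a ls * path_csf ls \<alpha>)"
proof -
  have "of_nat (chrom_coeff V E \<alpha>) = (\<Sum>ls\<in>{ls. a ls \<noteq> 0}. a ls * path_csf ls \<alpha>)"
    using assms(1) by (simp add: path_expansion_def path_csf_def)
  also have "\<dots> = (\<Sum>ls\<in>bounded_partitions N. a ls * path_csf ls \<alpha>)"
    by (rule sum.mono_neutral_left[OF finite_bounded_partitions assms(2)]) auto
  finally show ?thesis .
qed

lemma path_expansion_unique:
  assumes a: "path_expansion V E a" and b: "path_expansion V E b"
  shows "a = b"
proof -
  let ?S = "{ls. a ls \<noteq> 0} \<union> {ls. b ls \<noteq> 0}"
  have "finite ?S" "\<forall>ls\<in>?S. is_partition ls" using a b by (auto simp: path_expansion_def)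
  \<comment> \<open>The two supports are unrelated, possibly with partitions of different sizes. The
    sum of all sizes is a crude bound that places both in one finite independent family.\<close>
  define N where "N = (\<Sum>ls\<in>?S. card (path_vertices ls))"
  have "card (path_vertices ls) \<le> N" if "ls \<in> ?S" for ls
    unfolding N_def using that \<open>finite ?S\<close> by (intro member_le_sum) auto
  with \<open>\<forall>ls\<in>?S. is_partition ls\<close> have sub: "?S \<subseteq> bounded_partitions N"
    by (auto simp: bounded_partitions_def)
  have "(\<Sum>ls\<in>bounded_partitions N. (a ls - b ls) * path_csf ls \<alpha>) = 0" for \<alpha>
    using path_expansion_sum[OF a, of N \<alpha>] path_expansion_sum[OF b, of N \<alpha>] sub
    by (simp add: left_diff_distrib sum_subtractf)
  then have "a ls - b ls = 0" if "ls \<in> bounded_partitions N" for ls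
    using path_csf_independent[where a = "\<lambda>ls. a ls - b ls" and N = N] that by blast
  then show ?thesis using sub by (intro ext) (metis (mono_tags, lifting) UnI1 UnI2 mem_Collect_eq right_minus_eq subsetD)
qed

text \<open>By uniqueness, any expansion over bounded partitions yields the coefficients chosen by
  \<open>path_coeffs\<close>. The relation \<open>path_functional\<close> thus determines
  \<open>tau\<close>.\<close>

lemma tau_eqI:
  assumes "path_functional N t (\<lambda>\<alpha>. of_nat (chrom_coeff V E \<alpha>)) y"
  shows "tau V E t = y"
proof -
  let ?I = "bounded_partitions N"
  obtain c where c: "\<And>\<alpha>. of_nat (chrom_coeff V E \<alpha>) = (\<Sum>ls\<in>?I. c ls * path_csf ls \<alpha>)"
      "y = (\<Sum>ls\<in>?I. c ls * t ^ length ls)"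
    using assms unfolding path_functional_def by blast
  \<comment> \<open>The witness \<open>c\<close> is unconstrained outside \<open>?I\<close>; setting
    it to 0 there gives the finite support that \<open>path_expansion\<close> demands.\<close>
  define a where "a ls = (if ls \<in> ?I then c ls else 0)" for ls
  have sub: "{ls. a ls \<noteq> 0} \<subseteq> ?I" by (auto simp: a_def)
  have sum: "(\<Sum>ls\<in>{ls. a ls \<noteq> 0}. a ls * g ls) = (\<Sum>ls\<in>?I. c ls * g ls)" for g
  proof -
    have "(\<Sum>ls\<in>{ls. a ls \<noteq> 0}. a ls * g ls) = (\<Sum>ls\<in>?I. a ls * g ls)"
      by (rule sum.mono_neutral_left[OF finite_bounded_partitions sub]) auto
    also have "\<dots> = (\<Sum>ls\<in>?I. c ls * g ls)" by (intro sum.cong) (simp_all add: a_def)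
    finally show ?thesis .
  qed
  have "path_expansion V E a"
    unfolding path_expansion_def
  proof (intro conjI allI impI)
    show "finite {ls. a ls \<noteq> 0}" using sub finite_bounded_partitions finite_subset by blast
    show "is_partition ls" if "a ls \<noteq> 0" for ls
      using sub that by (auto simp: bounded_partitions_def)
    show "of_nat (chrom_coeff V E \<alpha>) = (\<Sum>ls\<in>{ls. a ls \<noteq> 0}.
        a ls * of_nat (chrom_coeff (path_vertices ls) (path_edges ls) \<alpha>))" for \<alpha>
      using c(1)[of \<alpha>] sum[of "\<lambda>ls. path_csf ls \<alpha>"] by (simp add: path_csf_def)
  qed
  then have "path_coeffs V E = a"
    unfolding path_coeffs_def using path_expansion_unique by (intro the_equality)
  then show ?thesis using sum[of "\<lambda>ls. t ^ length ls"] c(2) by (simp add: tau_def)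
qed

section \<open>The forest formula\<close>

theorem theorem4p5:
  fixes V :: "'a set" and E :: "'a set set" and r :: "'a set rel" and x :: nat
  assumes "simple_graph V E"
    and "linear_order_on E r"
    and "0 < x"
  shows "tau V E (of_nat x) =
    (-1) ^ card V *
    (\<Sum>(F, c) \<in> {(F, c). internal_forest V E r F \<and> c \<in> V \<rightarrow>\<^sub>E {1..x} \<and> proper_colouring F c}.
        (-1) ^ num_components V F)"
proof -
  let ?K = "V \<rightarrow>\<^sub>E {1..x}"
  let ?N = "nbc_sets V E r"
  have V: "finite V" and E: "E \<subseteq> graph_edges V"
    using assms(1) by (auto simp: simple_graph_def graph_edges_def)
  then have finE: "finite E" using finite_graph_edges finite_subset by blast
  have acyclic: "\<nexists>C. is_cycle V F C" if "F \<in> ?N" for F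
    using nbc_sets_acyclic[OF finE assms(2) that] by blast
  have edges: "F \<subseteq> graph_edges V" if "F \<in> ?N" for F
    using that E by (auto simp: nbc_sets_def)
  have internal: "internal_forest V E r F \<longleftrightarrow> F \<in> ?N" for F
    using acyclic by (auto simp: internal_forest_def spanning_forest_def nbc_sets_def)
  have fin: "finite ?N"
    by (rule finite_subset[of _ "Pow E"]) (use finE in \<open>auto simp: nbc_sets_def\<close>)
  have finK: "finite ?K" using V by (simp add: finite_PiE)
  let ?col = "\<lambda>F. of_nat (card (mixed_colourings ?K F {})) :: rat"
  \<comment> \<open>At \<open>t = x\<close> the linear map takes the power sum of \<open>F\<close>
    to the number of its proper colourings with \<open>x\<close> colours, since both are the same
    product.\<close>
  have "path_functional (card V) (of_nat x)
      (\<lambda>\<alpha>. of_nat (card (mixed_colourings (content_maps V \<alpha>) {} F))) (?col F)" if "F \<in> ?N" for F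
  proof -
    have "?col F = of_nat x ^ num_components V F * (of_nat x - 1) ^ card F"
      using card_mixed_colourings_forest[OF V, of F "{}" x] edges[OF that] acyclic[OF that] by simp
    then show ?thesis using path_functional_forest[OF V edges[OF that] acyclic[OF that]] by simp
  qed
  \<comment> \<open>Linearity, applied to the broken circuit expansion of every coefficient of
    \<open>X\<close>.\<close>
  from path_functional_sum[of ?N, OF this, of "\<lambda>F. F" "\<lambda>F. (-1) ^ card F"]
  have "path_functional (card V) (of_nat x) (\<lambda>\<alpha>. of_nat (chrom_coeff V E \<alpha>))
      (\<Sum>F\<in>?N. (-1) ^ card F * ?col F)"
    unfolding chrom_coeff_eq card_proper_eq_sum_nbc_sets[OF finE assms(2) E finite_content_maps[OF V]]
    by simp
  then have "tau V E (of_nat x) = (\<Sum>F\<in>?N. (-1) ^ card F * ?col F)" by (rule tau_eqI)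
  also have "\<dots> = (\<Sum>F\<in>?N. \<Sum>c\<in>mixed_colourings ?K F {}. (-1) ^ card V * (-1) ^ num_components V F)"
  proof (rule sum.cong)
    fix F assume "F \<in> ?N"
    then have "card V = num_components V F + card F"
      using num_components_forest[OF V edges acyclic] by simp
    \<comment> \<open>The exponents \<open>card F\<close> and
      \<open>card V + num_components V F\<close> differ by twice the number of components, so the
      signs agree.\<close>
    then have "(-1 :: rat) ^ card F = (-1) ^ card V * (-1) ^ num_components V F"
      by (simp add: power_add mult.commute mult.left_commute flip: power_mult_distrib)
    then show "(-1) ^ card F * ?col F =
        (\<Sum>c\<in>mixed_colourings ?K F {}. (-1) ^ card V * (-1) ^ num_components V F)"
      by simp
  qed simp
  also have "\<dots> = (-1) ^ card V * (\<Sum>F\<in>?N. \<Sum>c\<in>mixed_colourings ?K F {}. (-1) ^ num_components V F)"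
    by (simp only: sum_distrib_left)
  also have "(\<Sum>F\<in>?N. \<Sum>c\<in>mixed_colourings ?K F {}. (-1 :: rat) ^ num_components V F) =
      (\<Sum>(F, c)\<in>Sigma ?N (\<lambda>F. mixed_colourings ?K F {}). (-1) ^ num_components V F)"
    by (rule sum.Sigma) (use fin finK in \<open>auto simp: mixed_colourings_def\<close>)
  also have "Sigma ?N (\<lambda>F. mixed_colourings ?K F {}) =
      {(F, c). internal_forest V E r F \<and> c \<in> ?K \<and> proper_colouring F c}"
    by (auto simp: mixed_colourings_def edge_constant_def internal)
  finally show ?thesis .
qed

end
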